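(* Assume the following hypothesis $(\mathrm{H}_3)$: for every $n\ge3$, every $\rho\in[-1,0]$ and every measurable $f:\mathbb{R}^n\to B^3$, $\mathrm{Stab}_\rho[f]\ge\mathrm{Stab}_\rho[f^{(3)}_{\mathrm{opt}}]$, where $f^{(3)}_{\mathrm{opt}}(x)=(x_1,x_2,x_3)/\|(x_1,x_2,x_3)\|$. Then \[\inf_G\frac{\mathrm{Prod}(G)}{\mathrm{SDP}_{\mathrm{Prod}}(G)}=\alpha_{\mathrm{BOV}},\] the infimum being over all weighted graphs $G$.
   Context: $\mathbf{x}\sim_\rho\mathbf{y}$ are $\rho$-correlated standard Gaussian vectors in $\mathbb{R}^n$ and $\mathrm{Stab}_\rho[f]=\mathbb{E}\langle f(\mathbf{x}),f(\mathbf{y})\rangle$. A weighted graph $G=(V,E,w)$ is a finite undirected graph with nonnegative edge weights summing to $1$; $(\mathbf{u},\mathbf{v})\sim E$ is a random edge. $\mathrm{Prod}(G)=\max_{f:V\to S^2}\mathbb{E}[\tfrac14-\tfrac14\langle f(\mathbf{u}),f(\mathbf{v})\rangle]$ and $\mathrm{SDP}_{\mathrm{Prod}}(G)=\max_{f:V\to S^{|V|-1}}\mathbb{E}[\tfrac14-\tfrac14\langle f(\mathbf{u}),f(\mathbf{v})\rangle]$. $F^*(k,\rho)=\mathbb{E}\langle\mathbf{Z}u/\|\mathbf{Z}u\|,\mathbf{Z}v/\|\mathbf{Z}v\|\rangle$ for unit $u,v$ with $\langle u,v\rangle=\rho$ and $\mathbf{Z}$ a $k\times m$ standard Gaussian matrix;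 $\alpha_{\mathrm{BOV}}=\min_{-1\le\rho<1}\frac{1-F^*(3,\rho)}{1-\rho}$. *)

theory Defs
  imports "HOL-Probability.Probability"
begin

definition gauss_on :: "'i set \<Rightarrow> ('i \<Rightarrow> real) measure" where
  "gauss_on I = PiM I (\<lambda>_. density lborel std_normal_density)"

definition gauss :: "nat \<Rightarrow> (nat \<Rightarrow> real) measure" where
  "gauss n = gauss_on {..<n}"

(* rho-correlated partner: y = rho x + sqrt(1-rho^2) z, with x, z independent standard Gaussians *)
definition corr_partner :: "nat \<Rightarrow> real \<Rightarrow> (nat \<Rightarrow> real) \<Rightarrow> (nat \<Rightarrow> real) \<Rightarrow> (nat \<Rightarrow> real)" where
  "corr_partner n \<rho> x z = (\<lambda>i\<in>{..<n}. \<rho> * x i + sqrt (1 - \<rho>\<^sup>2) * z i)"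

definition Stab :: "nat \<Rightarrow> real \<Rightarrow> ((nat \<Rightarrow> real) \<Rightarrow> real^3) \<Rightarrow> real" where
  "Stab n \<rho> f = (\<integral>p. inner (f (fst p)) (f (corr_partner n \<rho> (fst p) (snd p))) \<partial>(gauss n \<Otimes>\<^sub>M gauss n))"

definition f_opt3 :: "(nat \<Rightarrow> real) \<Rightarrow> real^3" where
  "f_opt3 x = (let p = (vector [x 0, x 1, x 2] :: real^3) in (1 / norm p) *\<^sub>R p)"

definition H3 :: bool where
  "H3 \<longleftrightarrow> (\<forall>n\<ge>3. \<forall>\<rho>\<in>{-1..0}. \<forall>f :: (nat \<Rightarrow> real) \<Rightarrow> real^3.
      f \<in> borel_measurable (gauss n) \<and> (\<forall>x\<in>space (gauss n). norm (f x) \<le> 1)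
      \<longrightarrow> Stab n \<rho> f \<ge> Stab n \<rho> f_opt3)"

(* A weighted graph: vertex set {..<N}; the (undirected) edge {i,j}, i<j<N, has weight w i j >= 0;
   weights sum to 1 (pairs of weight 0 are non-edges). *)
definition weighted_graph :: "nat \<Rightarrow> (nat \<Rightarrow> nat \<Rightarrow> real) \<Rightarrow> bool" where
  "weighted_graph N w \<longleftrightarrow> (\<forall>i j. i < j \<and> j < N \<longrightarrow> w i j \<ge> 0)
      \<and> (\<Sum>j<N. \<Sum>i<j. w i j) = 1"

definition edge_obj :: "nat \<Rightarrow> (nat \<Rightarrow> nat \<Rightarrow> real) \<Rightarrow> (nat \<Rightarrow> nat \<Rightarrow> real) \<Rightarrow> real" where
  "edge_obj N w ip = (\<Sum>j<N. \<Sum>i<j. w i j * (1/4 - 1/4 * ip i j))"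

definition ProdG :: "nat \<Rightarrow> (nat \<Rightarrow> nat \<Rightarrow> real) \<Rightarrow> real" where
  "ProdG N w = (SUP f \<in> {f :: nat \<Rightarrow> real^3. \<forall>i<N. f i \<in> sphere 0 1}.
                  edge_obj N w (\<lambda>i j. inner (f i) (f j)))"

definition SDP_Prod :: "nat \<Rightarrow> (nat \<Rightarrow> nat \<Rightarrow> real) \<Rightarrow> real" where
  "SDP_Prod N w = (SUP f \<in> {f :: nat \<Rightarrow> nat \<Rightarrow> real. \<forall>i<N. (\<Sum>k<N. (f i k)\<^sup>2) = 1}.
                  edge_obj N w (\<lambda>i j. \<Sum>k<N. f i k * f j k))"

(* F*(k,rho) = E < Zu/||Zu||, Zv/||Zv|| >, with m = 2, u = (1,0), v = (rho, sqrt(1-rho^2)),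
   Z a k x 2 standard Gaussian matrix (entries indexed by {..<k} x {..<2}). *)
definition Fstar :: "nat \<Rightarrow> real \<Rightarrow> real" where
  "Fstar k \<rho> =
    (let u = (\<lambda>j::nat. if j = 0 then 1 else 0);
         v = (\<lambda>j::nat. if j = 0 then \<rho> else sqrt (1 - \<rho>\<^sup>2));
         mulv = (\<lambda>Z a (i::nat). \<Sum>j<2. Z (i, j) * a j);
         nrm = (\<lambda>y. sqrt (\<Sum>i<k. (y i)\<^sup>2))
     in \<integral>Z. (\<Sum>i<k. (mulv Z u i / nrm (mulv Z u)) * (mulv Z v i / nrm (mulv Z v)))
          \<partial>(gauss_on ({..<k} \<times> {..<2})))"

definition alpha_BOV :: real where
  "alpha_BOV = (INF \<rho> \<in> {-1..<1}. (1 - Fstar 3 \<rho>) / (1 - \<rho>))"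

end

theory Submission
  imports Defs
begin

text \<open>
  Write F for F*(3, .). For unit vectors u, v and a Gaussian matrix Z, the pair (Zu, Zv) has a law
  depending only on the inner product of u and v, so rounding each SDP vector u to Zu/|Zu| has
  expected value (1 - F)/4 on each edge; this gives Prod \<ge> alpha SDP.

  Conversely, for \<rho> \<le> 0 discretise the graph on the unit directions of n-dimensional space whose edges
  are \<rho>-correlated Gaussian pairs. The identity embedding is an SDP solution of value about
  (1 - \<rho>)/4 by concentration of the norm, while the hypothesis bounds every
  3-dimensional solution by (1 - F(\<rho>))/4. For \<rho> > 0 the ratio (1 - F(\<rho>))/(1 - \<rho>) is at least its
  value 1 at \<rho> = 0: since F is positive definite on spheres of every dimension and F(0) = 0, testing
  positive definiteness on two configurations gives F(r) \<le> 2r and F(r)^2 \<le> F(r^2), which force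
  F(r) \<le> r.
\<close>

section \<open>Rotation invariance of Gaussian pairs\<close>

text \<open>The hypothesis covers \<rho> in [-1, 0] only, while the infimum in
  \<open>alpha_BOV\<close> ranges over [-1, 1); this gap is why F(r) \<le> r on [0, 1] is proved
  separately. A power series of F with nonnegative coefficients would give it at once. The argument
  here extracts it from positive definiteness alone, which the rounding itself supplies: F of a Gram
  matrix is an expected Gram matrix.

  Correlated Gaussians occur in three guises: two linear images of one matrix with three rows
  (rounding), the two-column matrix of \<open>Fstar\<close>, and independent x, z with y = \<rho> x
  + sqrt(1 - \<rho>^2) z (stability). They are compared through one reference law,
  \<open>corr_normal\<close>, taken independently over coordinates; hence the work on linear images
  of Gaussian families.

  A graph has finitely many vertices and its SDP offers only |V| dimensions, so the Gaussian graph
  is a finite partition by direction with at least n vertices. Normalising and partitioning cost an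
  error of order 1 / sqrt n in the correlation, which disappears as n grows.\<close>

abbreviation std_normal :: "real measure" where
  "std_normal \<equiv> density lborel std_normal_density"

lemma prob_space_std_normal: "prob_space std_normal"
  by (rule prob_space_normal_density) simp

lemma nn_integral_lborel_shear:
  fixes h :: "real \<times> real \<Rightarrow> ennreal"
  assumes [measurable]: "h \<in> borel_measurable (borel \<Otimes>\<^sub>M borel)"
  shows "(\<integral>\<^sup>+y. \<integral>\<^sup>+x. h (x + t * y, y) \<partial>lborel \<partial>lborel) = (\<integral>\<^sup>+y. \<integral>\<^sup>+x. h (x, y) \<partial>lborel \<partial>lborel)"
proof (rule nn_integral_cong)
  fix y :: real
  show "(\<integral>\<^sup>+x. h (x + t * y, y) \<partial>lborel) = (\<integral>\<^sup>+x. h (x, y) \<partial>lborel)"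
    using nn_integral_real_affine[of "\<lambda>x. h (x, y)" 1 "t * y"] by (simp add: add.commute)
qed

lemma nn_integral_lborel_swap:
  fixes h :: "real \<times> real \<Rightarrow> ennreal"
  assumes [measurable]: "h \<in> borel_measurable (borel \<Otimes>\<^sub>M borel)"
  shows "(\<integral>\<^sup>+y. \<integral>\<^sup>+x. h (x, y) \<partial>lborel \<partial>lborel) = (\<integral>\<^sup>+x. \<integral>\<^sup>+y. h (x, y) \<partial>lborel \<partial>lborel)"
  using lborel_pair.Fubini'[of "\<lambda>x y. h (x, y)"] by simp

text \<open>A plane rotation by an angle other than \<open>\<pi>\<close> is a product of three shears.\<close>
lemma nn_integral_lborel_rotate:
  fixes h :: "real \<times> real \<Rightarrow> ennreal"
  assumes [measurable]: "h \<in> borel_measurable (borel \<Otimes>\<^sub>M borel)"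
    and cs: "c\<^sup>2 + s\<^sup>2 = 1" "c \<ge> 0"
  shows "(\<integral>\<^sup>+y. \<integral>\<^sup>+x. h (c * x - s * y, s * x + c * y) \<partial>lborel \<partial>lborel) = (\<integral>\<^sup>+y. \<integral>\<^sup>+x. h (x, y) \<partial>lborel \<partial>lborel)"
proof -
  \<comment> \<open>\<open>t\<close> is the tangent of half the angle with cosine \<open>c\<close>
    and sine \<open>s\<close>; \<open>c \<ge> 0\<close> keeps the denominator away from 0. The
    shears are x := x - t y, y := y + s x, x := x - t y.\<close>
  define t where "t = s / (1 + c)"
  have t: "1 - t * s = c" "t * (1 + c) = s"
    using cs by (auto simp: t_def field_simps power2_eq_square)
  have "(\<integral>\<^sup>+y. \<integral>\<^sup>+x. h (x, y) \<partial>lborel \<partial>lborel)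
      = (\<integral>\<^sup>+y. \<integral>\<^sup>+x. h (x + (- t) * y, y) \<partial>lborel \<partial>lborel)"
    by (rule nn_integral_lborel_shear[symmetric]) simp
  also have "\<dots> = (\<integral>\<^sup>+x. \<integral>\<^sup>+y. h (x + (- t) * y, y) \<partial>lborel \<partial>lborel)"
    using nn_integral_lborel_swap[of "\<lambda>(x,y). h (x + (- t) * y, y)"] by simp
  also have "\<dots> = (\<integral>\<^sup>+x. \<integral>\<^sup>+y. h (x + (- t) * (y + s * x), y + s * x) \<partial>lborel \<partial>lborel)"
    using nn_integral_lborel_shear[of "\<lambda>(y,x). h (x + (- t) * y, y)" s] by simp
  also have "\<dots> = (\<integral>\<^sup>+y. \<integral>\<^sup>+x. h (x + (- t) * (y + s * x), y + s * x) \<partial>lborel \<partial>lborel)"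
    using nn_integral_lborel_swap[of "\<lambda>(x,y). h (x + (- t) * (y + s * x), y + s * x)"] by simp
  also have "\<dots> = (\<integral>\<^sup>+y. \<integral>\<^sup>+x. h ((x + (- t) * y) + (- t) * (y + s * (x + (- t) * y)), y + s * (x + (- t) * y)) \<partial>lborel \<partial>lborel)"
    using nn_integral_lborel_shear[of "\<lambda>(x,y). h (x + (- t) * (y + s * x), y + s * x)" "-t"]
    by simp
  also have "\<dots> = (\<integral>\<^sup>+y. \<integral>\<^sup>+x. h (c * x - s * y, s * x + c * y) \<partial>lborel \<partial>lborel)"
  proof (intro nn_integral_cong arg_cong[where f = h] prod_eqI; simp)
    fix x y
    have "x - t * y - t * (y + s * (x - t * y)) = (1 - t * s) * x - (t * (1 + (1 - t * s))) * y"
      by (simp add: algebra_simps)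
    also have "\<dots> = c * x - s * y" by (simp add: t)
    finally show "x - t * y - t * (y + s * (x - t * y)) = c * x - s * y" .
    have "y + s * (x - t * y) = s * x + (1 - t * s) * y" by (simp add: algebra_simps)
    then show "y + s * (x - t * y) = s * x + c * y" by (simp add: t)
  qed
  finally show ?thesis by simp
qed

lemma nn_integral_std_normal_pair:
  fixes h :: "real \<times> real \<Rightarrow> ennreal"
  assumes [measurable]: "h \<in> borel_measurable (borel \<Otimes>\<^sub>M borel)"
  shows "(\<integral>\<^sup>+y. \<integral>\<^sup>+x. h (x, y) \<partial>std_normal \<partial>std_normal)
    = (\<integral>\<^sup>+y. \<integral>\<^sup>+x. ennreal (exp (- (x\<^sup>2 + y\<^sup>2) / 2) / (2 * pi)) * h (x, y) \<partial>lborel \<partial>lborel)"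
proof -
  have "ennreal (std_normal_density y) * (ennreal (std_normal_density x) * h (x, y))
      = ennreal (exp (- (x\<^sup>2 + y\<^sup>2) / 2) / (2 * pi)) * h (x, y)" for x y
  proof -
    have "std_normal_density y * std_normal_density x = exp (- (x\<^sup>2 + y\<^sup>2) / 2) / (2 * pi)"
      by (simp add: std_normal_density_def exp_add[symmetric] add_divide_distrib[symmetric] diff_divide_distrib[symmetric])
    then show ?thesis
      by (simp add: mult.assoc[symmetric] ennreal_mult[symmetric])
  qed
  then show ?thesis
    by (simp add: nn_integral_density nn_integral_cmult[symmetric])
qed

text \<open>The joint density depends on x^2 + y^2 alone, which a rotation preserves, so the
  invariance of Lebesgue measure carries over.\<close>

lemma nn_integral_std_normal_rotate:
  fixes h :: "real \<times> real \<Rightarrow> ennreal"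
  assumes [measurable]: "h \<in> borel_measurable (borel \<Otimes>\<^sub>M borel)"
    and cs: "c\<^sup>2 + s\<^sup>2 = 1" "c \<ge> 0"
  shows "(\<integral>\<^sup>+y. \<integral>\<^sup>+x. h (c * x - s * y, s * x + c * y) \<partial>std_normal \<partial>std_normal)
    = (\<integral>\<^sup>+y. \<integral>\<^sup>+x. h (x, y) \<partial>std_normal \<partial>std_normal)"
proof -
  have [simp]: "(c * x - s * y)\<^sup>2 + (s * x + c * y)\<^sup>2 = x\<^sup>2 + y\<^sup>2" for x y
  proof -
    have "(c * x - s * y)\<^sup>2 + (s * x + c * y)\<^sup>2 = (c\<^sup>2 + s\<^sup>2) * x\<^sup>2 + (c\<^sup>2 + s\<^sup>2) * y\<^sup>2"
      by (simp add: algebra_simps power2_eq_square)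
    then show ?thesis by (simp add: cs)
  qed
  show ?thesis
    using nn_integral_lborel_rotate[of "\<lambda>(x, y). ennreal (exp (- (x\<^sup>2 + y\<^sup>2) / 2) / (2 * pi)) * h (x, y)" c s] cs
      nn_integral_std_normal_pair[of "\<lambda>(x,y). h (c * x - s * y, s * x + c * y)"]
    by (simp add: nn_integral_std_normal_pair del: minus_add_distrib)
qed

lemma nn_integral_std_normal_swap:
  fixes h :: "real \<times> real \<Rightarrow> ennreal"
  assumes [measurable]: "h \<in> borel_measurable (borel \<Otimes>\<^sub>M borel)"
  shows "(\<integral>\<^sup>+y. \<integral>\<^sup>+x. h (x, y) \<partial>std_normal \<partial>std_normal) = (\<integral>\<^sup>+x. \<integral>\<^sup>+y. h (x, y) \<partial>std_normal \<partial>std_normal)"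
proof -
  interpret prob_space std_normal by (rule prob_space_std_normal)
  interpret pair_sigma_finite std_normal std_normal ..
  show ?thesis by (rule Fubini'[of "\<lambda>x y. h (x, y)"]) simp
qed

lemma emeasure_std_normal_UNIV [simp]: "emeasure std_normal UNIV = 1"
  using prob_space.emeasure_space_1[OF prob_space_std_normal] by simp

text \<open>Rotating by the angle of (\<gamma>, \<delta>) turns \<gamma> y + \<delta> t into r y,
  after which t integrates out. The sign condition makes the cosine \<gamma> / r nonnegative, as the
  rotation lemma asks.\<close>

lemma nn_integral_std_normal_add:
  fixes k :: "real \<Rightarrow> ennreal"
  assumes [measurable]: "k \<in> borel_measurable borel" and "\<gamma> \<ge> 0"
  shows "(\<integral>\<^sup>+t. \<integral>\<^sup>+y. k (\<gamma> * y + \<delta> * t) \<partial>std_normal \<partial>std_normal) = (\<integral>\<^sup>+y. k (sqrt (\<gamma>\<^sup>2 + \<delta>\<^sup>2) * y) \<partial>std_normal)"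
proof (cases "sqrt (\<gamma>\<^sup>2 + \<delta>\<^sup>2) = 0")
  case True
  then have "\<gamma> = 0" "\<delta> = 0" by (simp_all add: sum_power2_eq_zero_iff)
  then show ?thesis by simp
next
  case False
  define r where "r = sqrt (\<gamma>\<^sup>2 + \<delta>\<^sup>2)"
  have r: "r > 0" "r\<^sup>2 = \<gamma>\<^sup>2 + \<delta>\<^sup>2"
    using False by (auto simp: r_def less_le)
  have "(\<gamma> / r)\<^sup>2 + (\<delta> / r)\<^sup>2 = 1"
    unfolding power_divide add_divide_distrib[symmetric] r(2)[symmetric] using r(1) by simp
  then have "(\<integral>\<^sup>+t. \<integral>\<^sup>+y. k (\<gamma> * y + \<delta> * t) \<partial>std_normal \<partial>std_normal)
      = (\<integral>\<^sup>+t. \<integral>\<^sup>+y. k (\<gamma> * (\<gamma> / r * y - \<delta> / r * t) + \<delta> * (\<delta> / r * y + \<gamma> / r * t)) \<partial>std_normal \<partial>std_normal)"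
    using nn_integral_std_normal_rotate[of "\<lambda>(y,t). k (\<gamma> * y + \<delta> * t)" "\<gamma> / r" "\<delta> / r"] r \<open>\<gamma> \<ge> 0\<close>
    by simp
  also have "\<dots> = (\<integral>\<^sup>+t. \<integral>\<^sup>+y. k (r * y) \<partial>std_normal \<partial>std_normal)"
  proof (intro nn_integral_cong arg_cong[where f = k])
    fix y t
    have "\<gamma> * (\<gamma> / r * y - \<delta> / r * t) + \<delta> * (\<delta> / r * y + \<gamma> / r * t) = (\<gamma>\<^sup>2 + \<delta>\<^sup>2) / r * y"
      using r by (simp add: field_simps power2_eq_square)
    also have "\<dots> = r * y"
      unfolding r(2)[symmetric] using r(1) by (simp add: power2_eq_square)
    finally show "\<gamma> * (\<gamma> / r * y - \<delta> / r * t) + \<delta> * (\<delta> / r * y + \<gamma> / r * t) = r * y" .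
  qed
  finally show ?thesis by (simp add: r_def)
qed

text \<open>One update of a Cholesky factor: a new normal t enters with coefficients a, b. A Givens
  rotation in the (x, t)-plane removes t from the upper coordinate, and what is left of t in the
  lower one is merged with y. The equations say that the Gram entries grow by a^2, ab and b^2.
  Nonnegative \<alpha>', \<gamma>' allow the step to be repeated.\<close>

lemma nn_integral_std_normal_absorb:
  assumes "\<alpha> \<ge> 0" "\<gamma> \<ge> 0"
  shows "\<exists>\<alpha>' \<beta>' \<gamma>'. \<alpha>' \<ge> 0 \<and> \<gamma>' \<ge> 0 \<and> \<alpha>'\<^sup>2 = \<alpha>\<^sup>2 + a\<^sup>2 \<and> \<alpha>' * \<beta>' = \<alpha> * \<beta> + a * b \<and> \<beta>'\<^sup>2 + \<gamma>'\<^sup>2 = \<beta>\<^sup>2 + \<gamma>\<^sup>2 + b\<^sup>2 \<and>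
    (\<forall>h \<in> borel_measurable (borel \<Otimes>\<^sub>M borel).
      (\<integral>\<^sup>+t. \<integral>\<^sup>+y. \<integral>\<^sup>+x. h (\<alpha> * x + a * t, \<beta> * x + \<gamma> * y + b * t) \<partial>std_normal \<partial>std_normal \<partial>std_normal)
      = (\<integral>\<^sup>+y. \<integral>\<^sup>+x. (h (\<alpha>' * x, \<beta>' * x + \<gamma>' * y) :: ennreal) \<partial>std_normal \<partial>std_normal))"
proof -
  define r where "r = sqrt (\<alpha>\<^sup>2 + a\<^sup>2)"
  \<comment> \<open>The angle is that of the vector (\<alpha>, a); if this vector is 0, the identity
    rotation serves.\<close>
  have "\<exists>c s. c \<ge> 0 \<and> c\<^sup>2 + s\<^sup>2 = 1 \<and> \<alpha> * c + a * s = r \<and> a * c = \<alpha> * s"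
  proof (cases "r = 0")
    case True
    then have "\<alpha> = 0" "a = 0" by (simp_all add: r_def sum_power2_eq_zero_iff)
    moreover have "\<exists>c s. c \<ge> 0 \<and> c\<^sup>2 + s\<^sup>2 = (1 :: real)"
      by (rule exI[of _ 1], rule exI[of _ 0]) simp
    ultimately show ?thesis using True by simp
  next
    case False
    then have r: "r > 0" "r\<^sup>2 = \<alpha>\<^sup>2 + a\<^sup>2" by (auto simp: r_def less_le)
    have "(\<alpha> / r)\<^sup>2 + (a / r)\<^sup>2 = 1"
      unfolding power_divide add_divide_distrib[symmetric] r(2)[symmetric] using r(1) by simp
    moreover have "\<alpha> / r \<ge> 0" "\<alpha> * (\<alpha> / r) + a * (a / r) = r" "a * (\<alpha> / r) = \<alpha> * (a / r)"
      using r assms by (simp_all add: add_divide_distrib[symmetric] power2_eq_square divide_eq_eq)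
    ultimately show ?thesis by blast
  qed
  then obtain c s where cs: "c \<ge> 0" "c\<^sup>2 + s\<^sup>2 = 1" "\<alpha> * c + a * s = r" "a * c = \<alpha> * s" by blast
  have r: "r \<ge> 0" "r\<^sup>2 = \<alpha>\<^sup>2 + a\<^sup>2" by (auto simp: r_def)
  \<comment> \<open>\<beta>' and \<delta> are the rotated coordinates of (\<beta>, b): \<beta>' goes
    with the new x, and \<delta> is the residue of t that \<gamma>' takes up.\<close>
  define \<beta>' where "\<beta>' = \<beta> * c + b * s"
  define \<delta> where "\<delta> = b * c - \<beta> * s"
  define \<gamma>' where "\<gamma>' = sqrt (\<gamma>\<^sup>2 + \<delta>\<^sup>2)"
  have \<gamma>': "\<gamma>' \<ge> 0" "\<gamma>'\<^sup>2 = \<gamma>\<^sup>2 + \<delta>\<^sup>2" by (auto simp: \<gamma>'_def)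
  have "r * \<beta>' = \<alpha> * \<beta> * (c * c) + \<alpha> * s * b * c + a * c * \<beta> * s + a * b * (s * s)"
    by (simp add: cs(3)[symmetric] \<beta>'_def algebra_simps)
  also have "\<dots> = \<alpha> * \<beta> * (c * c) + a * c * b * c + \<alpha> * s * \<beta> * s + a * b * (s * s)"
    by (simp add: cs(4))
  also have "\<dots> = (\<alpha> * \<beta> + a * b) * (c\<^sup>2 + s\<^sup>2)"
    by (simp add: algebra_simps power2_eq_square)
  finally have 1: "r * \<beta>' = \<alpha> * \<beta> + a * b" by (simp add: cs)
  have "\<beta>'\<^sup>2 + \<delta>\<^sup>2 = (\<beta>\<^sup>2 + b\<^sup>2) * (c\<^sup>2 + s\<^sup>2)"
    by (simp add: \<beta>'_def \<delta>_def algebra_simps power2_eq_square)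
  then have 2: "\<beta>'\<^sup>2 + \<gamma>'\<^sup>2 = \<beta>\<^sup>2 + \<gamma>\<^sup>2 + b\<^sup>2" by (simp add: cs \<gamma>')
  have 3: "(\<integral>\<^sup>+t. \<integral>\<^sup>+y. \<integral>\<^sup>+x. h (\<alpha> * x + a * t, \<beta> * x + \<gamma> * y + b * t) \<partial>std_normal \<partial>std_normal \<partial>std_normal)
      = (\<integral>\<^sup>+y. \<integral>\<^sup>+x. h (r * x, \<beta>' * x + \<gamma>' * y) \<partial>std_normal \<partial>std_normal)"
    if [measurable]: "h \<in> borel_measurable (borel \<Otimes>\<^sub>M borel)" for h :: "real \<times> real \<Rightarrow> ennreal"
  proof -
    interpret prob_space std_normal by (rule prob_space_std_normal)
    have "(\<integral>\<^sup>+t. \<integral>\<^sup>+y. \<integral>\<^sup>+x. h (\<alpha> * x + a * t, \<beta> * x + \<gamma> * y + b * t) \<partial>std_normal \<partial>std_normal \<partial>std_normal)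
        = (\<integral>\<^sup>+y. \<integral>\<^sup>+t. \<integral>\<^sup>+x. h (\<alpha> * x + a * t, \<beta> * x + \<gamma> * y + b * t) \<partial>std_normal \<partial>std_normal \<partial>std_normal)"
      using nn_integral_std_normal_swap[of "\<lambda>(y,t). \<integral>\<^sup>+x. h (\<alpha> * x + a * t, \<beta> * x + \<gamma> * y + b * t) \<partial>std_normal"]
      by simp
    also have "\<dots> = (\<integral>\<^sup>+y. \<integral>\<^sup>+t. \<integral>\<^sup>+x. h (r * x, \<beta>' * x + \<delta> * t + \<gamma> * y) \<partial>std_normal \<partial>std_normal \<partial>std_normal)"
    proof (rule nn_integral_cong)
      fix y
      have "(\<integral>\<^sup>+t. \<integral>\<^sup>+x. h (\<alpha> * x + a * t, \<beta> * x + \<gamma> * y + b * t) \<partial>std_normal \<partial>std_normal)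
        = (\<integral>\<^sup>+t. \<integral>\<^sup>+x. h (\<alpha> * (c * x - s * t) + a * (s * x + c * t), \<beta> * (c * x - s * t) + \<gamma> * y + b * (s * x + c * t)) \<partial>std_normal \<partial>std_normal)"
        using nn_integral_std_normal_rotate[of "\<lambda>(x,t). h (\<alpha> * x + a * t, \<beta> * x + \<gamma> * y + b * t)" c s] cs by simp
      also have "\<dots> = (\<integral>\<^sup>+t. \<integral>\<^sup>+x. h (r * x, \<beta>' * x + \<delta> * t + \<gamma> * y) \<partial>std_normal \<partial>std_normal)"
      proof (intro nn_integral_cong arg_cong[where f = h] prod_eqI; simp only: fst_conv snd_conv)
        fix x t
        have "\<alpha> * (c * x - s * t) + a * (s * x + c * t) = (\<alpha> * c + a * s) * x + (a * c - \<alpha> * s) * t"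
          by (simp add: algebra_simps)
        then show "\<alpha> * (c * x - s * t) + a * (s * x + c * t) = r * x" by (simp add: cs(3) cs(4))
        show "\<beta> * (c * x - s * t) + \<gamma> * y + b * (s * x + c * t) = \<beta>' * x + \<delta> * t + \<gamma> * y"
          by (simp add: \<beta>'_def \<delta>_def algebra_simps)
      qed
      finally show "(\<integral>\<^sup>+t. \<integral>\<^sup>+x. h (\<alpha> * x + a * t, \<beta> * x + \<gamma> * y + b * t) \<partial>std_normal \<partial>std_normal) = \<dots>" .
    qed
    also have "\<dots> = (\<integral>\<^sup>+y. \<integral>\<^sup>+x. \<integral>\<^sup>+t. h (r * x, \<beta>' * x + \<delta> * t + \<gamma> * y) \<partial>std_normal \<partial>std_normal \<partial>std_normal)"
    proof (rule nn_integral_cong)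
      fix y
      show "(\<integral>\<^sup>+t. \<integral>\<^sup>+x. h (r * x, \<beta>' * x + \<delta> * t + \<gamma> * y) \<partial>std_normal \<partial>std_normal) = (\<integral>\<^sup>+x. \<integral>\<^sup>+t. h (r * x, \<beta>' * x + \<delta> * t + \<gamma> * y) \<partial>std_normal \<partial>std_normal)"
        using nn_integral_std_normal_swap[of "\<lambda>(x,t). h (r * x, \<beta>' * x + \<delta> * t + \<gamma> * y)"] by simp
    qed
    also have "\<dots> = (\<integral>\<^sup>+x. \<integral>\<^sup>+y. \<integral>\<^sup>+t. h (r * x, \<beta>' * x + \<delta> * t + \<gamma> * y) \<partial>std_normal \<partial>std_normal \<partial>std_normal)"
      using nn_integral_std_normal_swap[of "\<lambda>(x,y). \<integral>\<^sup>+t. h (r * x, \<beta>' * x + \<delta> * t + \<gamma> * y) \<partial>std_normal"] by simp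
    also have "\<dots> = (\<integral>\<^sup>+x. \<integral>\<^sup>+y. h (r * x, \<beta>' * x + \<gamma>' * y) \<partial>std_normal \<partial>std_normal)"
    proof (rule nn_integral_cong)
      fix x
      have "(\<integral>\<^sup>+y. \<integral>\<^sup>+t. h (r * x, \<beta>' * x + \<delta> * t + \<gamma> * y) \<partial>std_normal \<partial>std_normal)
        = (\<integral>\<^sup>+t. \<integral>\<^sup>+y. h (r * x, \<beta>' * x + \<delta> * t + \<gamma> * y) \<partial>std_normal \<partial>std_normal)"
        using nn_integral_std_normal_swap[of "\<lambda>(t,y). h (r * x, \<beta>' * x + \<delta> * t + \<gamma> * y)"] by simp
      also have "\<dots> = (\<integral>\<^sup>+y. h (r * x, \<beta>' * x + \<gamma>' * y) \<partial>std_normal)"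
        using nn_integral_std_normal_add[of "\<lambda>u. h (r * x, \<beta>' * x + u)" \<gamma> \<delta>] assms
        by (simp add: \<gamma>'_def add.assoc add.commute[of "\<delta> * _"])
      finally show "(\<integral>\<^sup>+y. \<integral>\<^sup>+t. h (r * x, \<beta>' * x + \<delta> * t + \<gamma> * y) \<partial>std_normal \<partial>std_normal) = \<dots>" .
    qed
    also have "\<dots> = (\<integral>\<^sup>+y. \<integral>\<^sup>+x. h (r * x, \<beta>' * x + \<gamma>' * y) \<partial>std_normal \<partial>std_normal)"
      using nn_integral_std_normal_swap[of "\<lambda>(x,y). h (r * x, \<beta>' * x + \<gamma>' * y)"] by simp
    finally show ?thesis .
  qed
  show ?thesis
    using r \<gamma>' 1 2 3 by blast
qed

section \<open>Joint laws of linear images of Gaussian families\<close>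

lemma prob_space_gauss_on: "prob_space (gauss_on I)"
  unfolding gauss_on_def by (intro prob_space_PiM prob_space_std_normal)

lemma sets_gauss_on [measurable_cong]: "sets (gauss_on I) = sets (PiM I (\<lambda>_. borel))"
  unfolding gauss_on_def by (intro sets_PiM_cong) simp_all

lemma space_gauss_on: "space (gauss_on I) = extensional I"
  by (simp add: gauss_on_def space_PiM PiE_UNIV_domain flip: extensional_def) (auto simp: PiE_def)

text \<open>The numbers \<open>\<alpha>, \<beta>, \<gamma>\<close> are the Cholesky factor of the Gram matrix of \<open>a, b\<close>.\<close>
lemma nn_integral_gauss_on_linear_pair:
  assumes "finite J"
  shows "\<exists>\<alpha> \<beta> \<gamma>. \<alpha> \<ge> 0 \<and> \<gamma> \<ge> 0 \<and> \<alpha>\<^sup>2 = (\<Sum>j\<in>J. (a j)\<^sup>2) \<and> \<alpha> * \<beta> = (\<Sum>j\<in>J. a j * b j) \<and> \<beta>\<^sup>2 + \<gamma>\<^sup>2 = (\<Sum>j\<in>J. (b j)\<^sup>2) \<and>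
    (\<forall>h \<in> borel_measurable (borel \<Otimes>\<^sub>M borel).
      (\<integral>\<^sup>+z. h (\<Sum>j\<in>J. z j * a j, \<Sum>j\<in>J. z j * b j) \<partial>gauss_on J)
      = (\<integral>\<^sup>+y. \<integral>\<^sup>+x. (h (\<alpha> * x, \<beta> * x + \<gamma> * y) :: ennreal) \<partial>std_normal \<partial>std_normal))"
  using assms
proof (induction J)
  case empty
  interpret product_sigma_finite "\<lambda>_. std_normal"
    by (intro product_sigma_finite.intro prob_space_imp_sigma_finite prob_space_std_normal)
  have "(\<integral>\<^sup>+z. (h (\<Sum>j\<in>{}. z j * a j, \<Sum>j\<in>{}. z j * b j) :: ennreal) \<partial>gauss_on {})
      = (\<integral>\<^sup>+y. \<integral>\<^sup>+x. h (0 * x, 0 * x + 0 * y) \<partial>std_normal \<partial>std_normal)" for h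
    by (simp add: gauss_on_def PiM_empty nn_integral_count_space_finite)
  then show ?case by (intro exI[of _ 0]) auto
next
  case (insert k J)
  interpret product_sigma_finite "\<lambda>_. std_normal"
    by (intro product_sigma_finite.intro prob_space_imp_sigma_finite prob_space_std_normal)
  from insert.IH obtain \<alpha> \<beta> \<gamma> where abc: "\<alpha> \<ge> 0" "\<gamma> \<ge> 0" "\<alpha>\<^sup>2 = (\<Sum>j\<in>J. (a j)\<^sup>2)" "\<alpha> * \<beta> = (\<Sum>j\<in>J. a j * b j)"
      "\<beta>\<^sup>2 + \<gamma>\<^sup>2 = (\<Sum>j\<in>J. (b j)\<^sup>2)"
     and IH: "\<And>h. h \<in> borel_measurable (borel \<Otimes>\<^sub>M borel) \<Longrightarrow>
      (\<integral>\<^sup>+z. h (\<Sum>j\<in>J. z j * a j, \<Sum>j\<in>J. z j * b j) \<partial>gauss_on J)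
      = (\<integral>\<^sup>+y. \<integral>\<^sup>+x. (h (\<alpha> * x, \<beta> * x + \<gamma> * y) :: ennreal) \<partial>std_normal \<partial>std_normal)"
    by blast
  from nn_integral_std_normal_absorb[OF abc(1,2), of "a k" \<beta> "b k"]
  obtain \<alpha>' \<beta>' \<gamma>' where abc': "\<alpha>' \<ge> 0" "\<gamma>' \<ge> 0" "\<alpha>'\<^sup>2 = \<alpha>\<^sup>2 + (a k)\<^sup>2" "\<alpha>' * \<beta>' = \<alpha> * \<beta> + a k * b k" "\<beta>'\<^sup>2 + \<gamma>'\<^sup>2 = \<beta>\<^sup>2 + \<gamma>\<^sup>2 + (b k)\<^sup>2"
    and absorb: "\<And>h. h \<in> borel_measurable (borel \<Otimes>\<^sub>M borel) \<Longrightarrow>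
      (\<integral>\<^sup>+t. \<integral>\<^sup>+y. \<integral>\<^sup>+x. h (\<alpha> * x + a k * t, \<beta> * x + \<gamma> * y + b k * t) \<partial>std_normal \<partial>std_normal \<partial>std_normal)
      = (\<integral>\<^sup>+y. \<integral>\<^sup>+x. (h (\<alpha>' * x, \<beta>' * x + \<gamma>' * y) :: ennreal) \<partial>std_normal \<partial>std_normal)"
    by blast
  have "(\<integral>\<^sup>+z. h (\<Sum>j\<in>insert k J. z j * a j, \<Sum>j\<in>insert k J. z j * b j) \<partial>gauss_on (insert k J))
      = (\<integral>\<^sup>+y. \<integral>\<^sup>+x. h (\<alpha>' * x, \<beta>' * x + \<gamma>' * y) \<partial>std_normal \<partial>std_normal)"
    if h[measurable]: "h \<in> borel_measurable (borel \<Otimes>\<^sub>M borel)" for h :: "real \<times> real \<Rightarrow> ennreal"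
  proof -
    have "(\<lambda>z. h (\<Sum>j\<in>insert k J. z j * a j, \<Sum>j\<in>insert k J. z j * b j)) \<in> borel_measurable (gauss_on (insert k J))"
      by measurable
    then have "(\<integral>\<^sup>+z. h (\<Sum>j\<in>insert k J. z j * a j, \<Sum>j\<in>insert k J. z j * b j) \<partial>gauss_on (insert k J))
      = (\<integral>\<^sup>+t. \<integral>\<^sup>+z. h (\<Sum>j\<in>insert k J. (z(k := t)) j * a j, \<Sum>j\<in>insert k J. (z(k := t)) j * b j) \<partial>gauss_on J \<partial>std_normal)"
      unfolding gauss_on_def by (intro product_nn_integral_insert_rev insert.hyps)
    also have "\<dots> = (\<integral>\<^sup>+t. \<integral>\<^sup>+z. h ((\<Sum>j\<in>J. z j * a j) + a k * t, (\<Sum>j\<in>J. z j * b j) + b k * t) \<partial>gauss_on J \<partial>std_normal)"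
    proof (intro nn_integral_cong arg_cong[where f = h])
      fix t z
      have "(\<Sum>j\<in>J. (z(k := t)) j * a j) = (\<Sum>j\<in>J. z j * a j)" for a :: "_ \<Rightarrow> real"
        using insert.hyps by (intro sum.cong) auto
      then show "(\<Sum>j\<in>insert k J. (z(k := t)) j * a j, \<Sum>j\<in>insert k J. (z(k := t)) j * b j) = ((\<Sum>j\<in>J. z j * a j) + a k * t, (\<Sum>j\<in>J. z j * b j) + b k * t)"
        using insert.hyps by (simp add: mult.commute)
    qed
    also have "\<dots> = (\<integral>\<^sup>+t. \<integral>\<^sup>+y. \<integral>\<^sup>+x. h (\<alpha> * x + a k * t, \<beta> * x + \<gamma> * y + b k * t) \<partial>std_normal \<partial>std_normal \<partial>std_normal)"
    proof (rule nn_integral_cong)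
      fix t
      show "(\<integral>\<^sup>+z. h ((\<Sum>j\<in>J. z j * a j) + a k * t, (\<Sum>j\<in>J. z j * b j) + b k * t) \<partial>gauss_on J)
         = (\<integral>\<^sup>+y. \<integral>\<^sup>+x. h (\<alpha> * x + a k * t, \<beta> * x + \<gamma> * y + b k * t) \<partial>std_normal \<partial>std_normal)"
        using IH[of "\<lambda>(p,q). h (p + a k * t, q + b k * t)"] by simp
    qed
    also note absorb[OF h]
    finally show ?thesis .
  qed
  moreover have "\<alpha>'\<^sup>2 = (\<Sum>j\<in>insert k J. (a j)\<^sup>2)" "\<alpha>' * \<beta>' = (\<Sum>j\<in>insert k J. a j * b j)"
      "\<beta>'\<^sup>2 + \<gamma>'\<^sup>2 = (\<Sum>j\<in>insert k J. (b j)\<^sup>2)"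
    using insert.hyps by (simp_all add: abc abc')
  ultimately show ?case using abc'(1,2) by blast
qed

text \<open>The reference law: rounding, \<open>Fstar\<close> and stability are all brought to
  integrals over independent copies of it.\<close>

definition corr_normal :: "real \<Rightarrow> (real \<times> real) measure" where
  "corr_normal \<rho> = distr (std_normal \<Otimes>\<^sub>M std_normal) (borel \<Otimes>\<^sub>M borel)
     (\<lambda>(x, y). (x, \<rho> * x + sqrt (1 - \<rho>\<^sup>2) * y))"

lemma sets_corr_normal [measurable_cong]: "sets (corr_normal \<rho>) = sets (borel \<Otimes>\<^sub>M borel)"
  by (simp add: corr_normal_def)

lemma prob_space_corr_normal: "prob_space (corr_normal \<rho>)"
proof -
  interpret prob_space std_normal by (rule prob_space_std_normal)
  interpret pair_prob_space std_normal std_normal ..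
  show ?thesis unfolding corr_normal_def by (intro prob_space_distr) simp
qed

lemma distr_gauss_on_pair:
  assumes J: "finite J" and a: "(\<Sum>j\<in>J. (a j)\<^sup>2) = 1" and b: "(\<Sum>j\<in>J. (b j)\<^sup>2) = 1"
  shows "distr (gauss_on J) (borel \<Otimes>\<^sub>M borel) (\<lambda>z. (\<Sum>j\<in>J. z j * a j, \<Sum>j\<in>J. z j * b j))
    = corr_normal (\<Sum>j\<in>J. a j * b j)"
proof (rule measure_eqI)
  interpret prob_space std_normal by (rule prob_space_std_normal)
  let ?\<rho> = "\<Sum>j\<in>J. a j * b j"
  let ?D = "distr (gauss_on J) (borel \<Otimes>\<^sub>M borel) (\<lambda>z. (\<Sum>j\<in>J. z j * a j, \<Sum>j\<in>J. z j * b j))"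
  show "sets ?D = sets (corr_normal ?\<rho>)"
    by (simp add: sets_corr_normal)
  fix A assume "A \<in> sets ?D"
  then have A[measurable]: "A \<in> sets (borel \<Otimes>\<^sub>M borel)" by simp
  obtain \<alpha> \<beta> \<gamma> where *: "\<alpha> \<ge> 0" "\<gamma> \<ge> 0" "\<alpha>\<^sup>2 = (\<Sum>j\<in>J. (a j)\<^sup>2)" "\<alpha> * \<beta> = ?\<rho>" "\<beta>\<^sup>2 + \<gamma>\<^sup>2 = (\<Sum>j\<in>J. (b j)\<^sup>2)"
    and eq: "\<And>h. h \<in> borel_measurable (borel \<Otimes>\<^sub>M borel) \<Longrightarrow>
      (\<integral>\<^sup>+z. h (\<Sum>j\<in>J. z j * a j, \<Sum>j\<in>J. z j * b j) \<partial>gauss_on J)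
      = (\<integral>\<^sup>+y. \<integral>\<^sup>+x. (h (\<alpha> * x, \<beta> * x + \<gamma> * y) :: ennreal) \<partial>std_normal \<partial>std_normal)"
    using nn_integral_gauss_on_linear_pair[OF J, of a b] by blast
  \<comment> \<open>Unit vectors with inner product \<rho> have the Cholesky factor 1, \<rho>,
    sqrt(1 - \<rho>^2), exactly the coefficients in \<open>corr_normal\<close>.\<close>
  have [simp]: "\<alpha> = 1" using *(1,3) a by (simp add: power2_eq_1_iff)
  have [simp]: "\<beta> = ?\<rho>" using *(4) by simp
  have [simp]: "\<gamma> = sqrt (1 - ?\<rho>\<^sup>2)" using *(2,5) b
    by (intro real_sqrt_unique[symmetric]) (auto simp: algebra_simps)
  have "emeasure ?D A = (\<integral>\<^sup>+p. indicator A p \<partial>?D)"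
    using A by simp
  also have "\<dots> = (\<integral>\<^sup>+z. indicator A (\<Sum>j\<in>J. z j * a j, \<Sum>j\<in>J. z j * b j) \<partial>gauss_on J)"
    by (subst nn_integral_distr) simp_all
  also have "\<dots> = (\<integral>\<^sup>+y. \<integral>\<^sup>+x. indicator A (x, ?\<rho> * x + sqrt (1 - ?\<rho>\<^sup>2) * y) \<partial>std_normal \<partial>std_normal)"
    by (subst eq) simp_all
  also have "\<dots> = (\<integral>\<^sup>+x. \<integral>\<^sup>+y. indicator A (x, ?\<rho> * x + sqrt (1 - ?\<rho>\<^sup>2) * y) \<partial>std_normal \<partial>std_normal)"
    using nn_integral_std_normal_swap[of "\<lambda>(x,y). indicator A (x, ?\<rho> * x + sqrt (1 - ?\<rho>\<^sup>2) * y)"] by simp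
  also have "\<dots> = (\<integral>\<^sup>+p. indicator A (fst p, ?\<rho> * fst p + sqrt (1 - ?\<rho>\<^sup>2) * snd p) \<partial>(std_normal \<Otimes>\<^sub>M std_normal))"
    by (subst nn_integral_fst[symmetric]) simp_all
  also have "\<dots> = (\<integral>\<^sup>+p. indicator A p \<partial>corr_normal ?\<rho>)"
    unfolding corr_normal_def by (subst nn_integral_distr) (simp_all add: case_prod_beta)
  also have "\<dots> = emeasure (corr_normal ?\<rho>) A"
    using A by (simp add: sets_corr_normal)
  finally show "emeasure ?D A = emeasure (corr_normal ?\<rho>) A" .
qed

text \<open>Different rows use disjoint blocks of independent matrix entries, so the pairs they
  produce are independent; within one row the law of a single pair applies.\<close>

lemma distr_gauss_on_rows:
  assumes I: "finite I" "I \<noteq> {}" and J: "finite J"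
    and a: "(\<Sum>j\<in>J. (a j)\<^sup>2) = 1" and b: "(\<Sum>j\<in>J. (b j)\<^sup>2) = 1"
  shows "distr (gauss_on (I \<times> J)) (PiM I (\<lambda>_. borel \<Otimes>\<^sub>M borel))
      (\<lambda>Z. \<lambda>i\<in>I. (\<Sum>j\<in>J. Z (i, j) * a j, \<Sum>j\<in>J. Z (i, j) * b j))
    = PiM I (\<lambda>_. corr_normal (\<Sum>j\<in>J. a j * b j))"
proof -
  interpret product_prob_space "\<lambda>_. std_normal" "I \<times> J"
    by (rule product_prob_spaceI) (rule prob_space_std_normal)
  interpret G: prob_space "gauss_on (I \<times> J)" by (rule prob_space_gauss_on)
  have "J \<noteq> {}" using a by auto
  have "G.indep_vars (\<lambda>_. std_normal) (\<lambda>k Z. Z k) (I \<times> J)"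
  proof (subst G.indep_vars_iff_distr_eq_PiM')
    show "I \<times> J \<noteq> {}" using I \<open>J \<noteq> {}\<close> by auto
    show "(\<lambda>Z. Z k) \<in> gauss_on (I \<times> J) \<rightarrow>\<^sub>M std_normal" if "k \<in> I \<times> J" for k
      using that unfolding gauss_on_def by (rule measurable_component_singleton)
    have "distr (gauss_on (I \<times> J)) (PiM (I \<times> J) (\<lambda>_. std_normal)) (\<lambda>Z. \<lambda>k\<in>I \<times> J. Z k)
      = PiM (I \<times> J) (\<lambda>_. std_normal)"
      unfolding gauss_on_def using distr_PiM_restrict_finite[of "I \<times> J"] I J by simp
    also have "\<dots> = PiM (I \<times> J) (\<lambda>k. distr (gauss_on (I \<times> J)) std_normal (\<lambda>Z. Z k))"
      unfolding gauss_on_def by (intro PiM_cong refl distr_PiM_component[symmetric] prob_space_std_normal)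
    finally show "distr (gauss_on (I \<times> J)) (PiM (I \<times> J) (\<lambda>_. std_normal)) (\<lambda>Z. \<lambda>k\<in>I \<times> J. Z k) = \<dots>" .
  qed
  then have "G.indep_vars (\<lambda>i. PiM ({i} \<times> J) (\<lambda>_. std_normal)) (\<lambda>i Z. restrict Z ({i} \<times> J)) I"
    by (rule G.indep_vars_restrict) (auto simp: disjoint_family_on_def)
  then have "G.indep_vars (\<lambda>_. borel \<Otimes>\<^sub>M borel)
      (\<lambda>i Z. (\<lambda>z. (\<Sum>k\<in>{i}\<times>J. z k * a (snd k), \<Sum>k\<in>{i}\<times>J. z k * b (snd k))) (restrict Z ({i} \<times> J))) I"
    by (rule G.indep_vars_compose2) (unfold gauss_on_def[symmetric], measurable)
  also have "(\<lambda>i Z. (\<lambda>z. (\<Sum>k\<in>{i}\<times>J. z k * a (snd k), \<Sum>k\<in>{i}\<times>J. z k * b (snd k))) (restrict Z ({i} \<times> J)))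
     = (\<lambda>i Z. (\<Sum>j\<in>J. Z (i, j) * a j, \<Sum>j\<in>J. Z (i, j) * b j))"
    by (simp add: sum.cartesian_product' del: restrict_apply cong: sum.cong) simp
  finally have ind: "G.indep_vars (\<lambda>_. borel \<Otimes>\<^sub>M borel) (\<lambda>i Z. (\<Sum>j\<in>J. Z (i, j) * a j, \<Sum>j\<in>J. Z (i, j) * b j)) I" .
  have law: "distr (gauss_on (I \<times> J)) (borel \<Otimes>\<^sub>M borel) (\<lambda>Z. (\<Sum>j\<in>J. Z (i, j) * a j, \<Sum>j\<in>J. Z (i, j) * b j))
      = corr_normal (\<Sum>j\<in>J. a j * b j)" if i: "i \<in> I" for i
  proof -
    have "distr (gauss_on (I \<times> J)) (gauss_on ({i} \<times> J)) (\<lambda>Z. restrict Z ({i} \<times> J)) = gauss_on ({i} \<times> J)"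
      unfolding gauss_on_def using i J by (intro distr_PiM_restrict_finite) auto
    then have "corr_normal (\<Sum>k\<in>{i}\<times>J. a (snd k) * b (snd k))
        = distr (distr (gauss_on (I \<times> J)) (gauss_on ({i} \<times> J)) (\<lambda>Z. restrict Z ({i} \<times> J))) (borel \<Otimes>\<^sub>M borel)
          (\<lambda>z. (\<Sum>k\<in>{i}\<times>J. z k * a (snd k), \<Sum>k\<in>{i}\<times>J. z k * b (snd k)))"
      using distr_gauss_on_pair[of "{i} \<times> J" "\<lambda>k. a (snd k)" "\<lambda>k. b (snd k)"] J a b
      by (simp add: sum.cartesian_product')
    also have "\<dots> = distr (gauss_on (I \<times> J)) (borel \<Otimes>\<^sub>M borel)
        (\<lambda>Z. (\<Sum>j\<in>J. Z (i, j) * a j, \<Sum>j\<in>J. Z (i, j) * b j))"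
    proof (subst distr_distr)
      show "(\<lambda>Z. restrict Z ({i} \<times> J)) \<in> gauss_on (I \<times> J) \<rightarrow>\<^sub>M gauss_on ({i} \<times> J)"
        unfolding gauss_on_def using i by (intro measurable_restrict_subset) auto
      show "distr (gauss_on (I \<times> J)) (borel \<Otimes>\<^sub>M borel)
         ((\<lambda>z. (\<Sum>k\<in>{i} \<times> J. z k * a (snd k), \<Sum>k\<in>{i} \<times> J. z k * b (snd k))) \<circ> (\<lambda>Z. restrict Z ({i} \<times> J))) =
        distr (gauss_on (I \<times> J)) (borel \<Otimes>\<^sub>M borel) (\<lambda>Z. (\<Sum>j\<in>J. Z (i, j) * a j, \<Sum>j\<in>J. Z (i, j) * b j))"
        by (intro distr_cong refl) (simp add: sum.cartesian_product')
    qed simp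
    finally show ?thesis by (simp add: sum.cartesian_product')
  qed
  have "distr (gauss_on (I \<times> J)) (PiM I (\<lambda>_. borel \<Otimes>\<^sub>M borel)) (\<lambda>Z. \<lambda>i\<in>I. (\<Sum>j\<in>J. Z (i, j) * a j, \<Sum>j\<in>J. Z (i, j) * b j))
     = PiM I (\<lambda>i. distr (gauss_on (I \<times> J)) (borel \<Otimes>\<^sub>M borel) (\<lambda>Z. (\<Sum>j\<in>J. Z (i, j) * a j, \<Sum>j\<in>J. Z (i, j) * b j)))"
    using ind I by (subst (asm) G.indep_vars_iff_distr_eq_PiM') auto
  also have "\<dots> = PiM I (\<lambda>_. corr_normal (\<Sum>j\<in>J. a j * b j))"
    by (intro PiM_cong refl law)
  finally show ?thesis .
qed

section \<open>The function F*(3, .)\<close>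

text \<open>The two vectors are given row by row, so that this is a function on the product over
  three rows. A vanishing norm makes the quotients 0, so the value stays in [-1, 1]
  everywhere.\<close>

definition unit_dot3 :: "(nat \<Rightarrow> real \<times> real) \<Rightarrow> real" where
  "unit_dot3 p = (\<Sum>i<3. (fst (p i) / sqrt (\<Sum>i<3. (fst (p i))\<^sup>2)) * (snd (p i) / sqrt (\<Sum>i<3. (snd (p i))\<^sup>2)))"

lemma measurable_unit_dot3 [measurable]:
  "unit_dot3 \<in> borel_measurable (PiM {..<3} (\<lambda>_. borel \<Otimes>\<^sub>M borel))"
  unfolding unit_dot3_def by measurable

lemma sets_PiM_corr_normal [measurable_cong]:
  "sets (PiM I (\<lambda>_. corr_normal \<rho>)) = sets (PiM I (\<lambda>_. borel \<Otimes>\<^sub>M borel))"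
  by (intro sets_PiM_cong sets_corr_normal) simp

text \<open>Coordinate \<open>i\<close> of Za / |Za| for a matrix Z with three rows. The column set
  \<open>J\<close> stays general: two columns for \<open>Fstar\<close>, 0 to m for the test
  configurations, the N coordinates of an SDP solution for rounding.\<close>

definition sphere_proj :: "'j set \<Rightarrow> ('j \<Rightarrow> real) \<Rightarrow> (nat \<times> 'j \<Rightarrow> real) \<Rightarrow> nat \<Rightarrow> real" where
  "sphere_proj J a Z i = (\<Sum>j\<in>J. Z (i, j) * a j) / sqrt (\<Sum>i<3. (\<Sum>j\<in>J. Z (i, j) * a j)\<^sup>2)"

lemma integral_sphere_proj_eq_corr:
  assumes "finite J" "(\<Sum>j\<in>J. (a j)\<^sup>2) = 1" "(\<Sum>j\<in>J. (b j)\<^sup>2) = 1"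
  shows "(\<integral>Z. (\<Sum>i<3. sphere_proj J a Z i * sphere_proj J b Z i) \<partial>gauss_on ({..<3} \<times> J))
    = (\<integral>p. unit_dot3 p \<partial>PiM {..<3} (\<lambda>_. corr_normal (\<Sum>j\<in>J. a j * b j)))"
proof -
  have "(\<integral>p. unit_dot3 p \<partial>PiM {..<3} (\<lambda>_. corr_normal (\<Sum>j\<in>J. a j * b j)))
    = (\<integral>Z. unit_dot3 (\<lambda>i\<in>{..<3}. (\<Sum>j\<in>J. Z (i, j) * a j, \<Sum>j\<in>J. Z (i, j) * b j)) \<partial>gauss_on ({..<3} \<times> J))"
    using assms by (subst distr_gauss_on_rows[symmetric]) (auto intro!: integral_distr simp: lessThan_empty_iff)
  also have "\<dots> = (\<integral>Z. (\<Sum>i<3. sphere_proj J a Z i * sphere_proj J b Z i) \<partial>gauss_on ({..<3} \<times> J))"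
    by (intro Bochner_Integration.integral_cong refl) (simp add: unit_dot3_def sphere_proj_def)
  finally show ?thesis ..
qed

lemma Fstar3_eq_corr:
  assumes "-1 \<le> \<rho>" "\<rho> \<le> 1"
  shows "Fstar 3 \<rho> = (\<integral>p. unit_dot3 p \<partial>PiM {..<3} (\<lambda>_. corr_normal \<rho>))"
proof -
  let ?u = "\<lambda>j::nat. if j = 0 then 1 else 0 :: real"
  let ?v = "\<lambda>j::nat. if j = 0 then \<rho> else sqrt (1 - \<rho>\<^sup>2)"
  have "\<rho>\<^sup>2 \<le> 1" using assms by (simp add: abs_square_le_1)
  then have "(\<Sum>j<2. (?u j)\<^sup>2) = 1" "(\<Sum>j<2. (?v j)\<^sup>2) = 1" "(\<Sum>j<2. ?u j * ?v j) = \<rho>"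
    by (simp_all add: numeral_2_eq_2)
  then show ?thesis
    using integral_sphere_proj_eq_corr[of "{..<2}" ?u ?v]
    by (simp add: Fstar_def Let_def sphere_proj_def)
qed

lemma abs_sum_mult_le_1:
  fixes a b :: "'j \<Rightarrow> real"
  assumes "(\<Sum>j\<in>J. (a j)\<^sup>2) \<le> 1" "(\<Sum>j\<in>J. (b j)\<^sup>2) \<le> 1"
  shows "\<bar>\<Sum>j\<in>J. a j * b j\<bar> \<le> 1"
proof -
  have "(\<Sum>j\<in>J. a j * b j)\<^sup>2 \<le> (\<Sum>j\<in>J. (a j)\<^sup>2) * (\<Sum>j\<in>J. (b j)\<^sup>2)"
    by (rule Cauchy_Schwarz_ineq_sum)
  also have "\<dots> \<le> 1 * 1"
    using assms by (intro mult_mono) (auto intro: sum_nonneg)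
  finally show ?thesis by (simp add: abs_square_le_1)
qed

lemma integral_sphere_proj:
  assumes "finite J" "(\<Sum>j\<in>J. (a j)\<^sup>2) = 1" "(\<Sum>j\<in>J. (b j)\<^sup>2) = 1"
  shows "(\<integral>Z. (\<Sum>i<3. sphere_proj J a Z i * sphere_proj J b Z i) \<partial>gauss_on ({..<3} \<times> J))
    = Fstar 3 (\<Sum>j\<in>J. a j * b j)"
proof -
  have "\<bar>\<Sum>j\<in>J. a j * b j\<bar> \<le> 1" using assms by (intro abs_sum_mult_le_1) auto
  then show ?thesis using assms by (simp add: integral_sphere_proj_eq_corr Fstar3_eq_corr abs_le_iff)
qed

lemma measurable_sphere_proj [measurable]:
  "i < 3 \<Longrightarrow> (\<lambda>Z. sphere_proj J a Z i) \<in> borel_measurable (gauss_on ({..<3} \<times> J))"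
  unfolding sphere_proj_def by measurable

text \<open>The value is 1, except that division by zero gives 0 at the zero vector. The inequality
  therefore holds everywhere, and integrability needs no exceptional set.\<close>

lemma sum_div_norm_sq_le_1: "(\<Sum>i\<in>I. (x i / sqrt (\<Sum>i\<in>I. (x i)\<^sup>2))\<^sup>2) \<le> (1::real)"
  by (simp add: power_divide sum_nonneg flip: sum_divide_distrib)

lemma sphere_proj_sq_le_1: "(\<Sum>i<3. (sphere_proj J a Z i)\<^sup>2) \<le> 1"
  unfolding sphere_proj_def by (rule sum_div_norm_sq_le_1)

lemma abs_sphere_proj_le_1: "i < 3 \<Longrightarrow> \<bar>sphere_proj J a Z i\<bar> \<le> 1"
proof -
  assume "i < 3"
  then have "(sphere_proj J a Z i)\<^sup>2 \<le> (\<Sum>i<3. (sphere_proj J a Z i)\<^sup>2)"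
    by (intro member_le_sum) auto
  also note sphere_proj_sq_le_1
  finally show ?thesis by (simp add: abs_square_le_1)
qed

lemma integrable_sphere_proj:
  assumes "i < 3"
  shows "integrable (gauss_on ({..<3} \<times> J)) (\<lambda>Z. sphere_proj J a Z i * sphere_proj J b Z i)"
proof -
  interpret prob_space "gauss_on ({..<3::nat} \<times> J)" by (rule prob_space_gauss_on)
  show ?thesis using assms
    by (intro integrable_const_bound[of _ 1])
       (auto simp: abs_mult intro!: mult_le_one abs_sphere_proj_le_1)
qed

section \<open>Elementary values and positive definiteness of F\<close>

lemma Fstar3_le_1:
  assumes "-1 \<le> \<rho>" "\<rho> \<le> 1"
  shows "Fstar 3 \<rho> \<le> 1"
proof -
  interpret prob_space "PiM {..<3::nat} (\<lambda>_. corr_normal \<rho>)"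
    by (intro prob_space_PiM prob_space_corr_normal)
  have le: "\<bar>unit_dot3 p\<bar> \<le> 1" for p
    unfolding unit_dot3_def by (intro abs_sum_mult_le_1 sum_div_norm_sq_le_1)
  have "Fstar 3 \<rho> \<le> (\<integral>p. 1 \<partial>PiM {..<3::nat} (\<lambda>_. corr_normal \<rho>))"
    unfolding Fstar3_eq_corr[OF assms]
    using le by (intro integral_mono integrable_const_bound[of _ 1] integrable_const) (auto simp: abs_le_iff)
  then show ?thesis by (simp add: prob_space)
qed

text \<open>Negating one of two orthogonal vectors keeps the inner product 0 but flips the sign of
  its rounding, so F(0) = -F(0).\<close>

lemma Fstar3_0: "Fstar 3 0 = 0"
proof -
  let ?a = "\<lambda>j::nat. if j = 0 then 1 else 0 :: real"
  let ?b = "\<lambda>j::nat. if j = 1 then 1 else 0 :: real"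
  have "sphere_proj {..<2} (\<lambda>j. - ?b j) Z i = - sphere_proj {..<2} ?b Z i" for Z and i :: nat
    by (simp add: sphere_proj_def sum_negf del: if_split split del: if_split)
  then have "Fstar 3 0 = - Fstar 3 0"
    using integral_sphere_proj[of "{..<2}" ?a "\<lambda>j. - ?b j"] integral_sphere_proj[of "{..<2}" ?a ?b]
    by (simp add: numeral_2_eq_2 sum_negf)
  then show ?thesis by simp
qed

text \<open>The quadratic form is the expected squared norm of the sum of the rounded vectors with
  weights \<open>c\<close>.\<close>

lemma Fstar3_positive_definite:
  assumes "finite J" "finite K" and u: "\<And>k. k \<in> K \<Longrightarrow> (\<Sum>j\<in>J. (u k j)\<^sup>2) = 1"
  shows "(\<Sum>k\<in>K. \<Sum>l\<in>K. c k * c l * Fstar 3 (\<Sum>j\<in>J. u k j * u l j)) \<ge> 0"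
proof -
  let ?G = "gauss_on ({..<3::nat} \<times> J)"
  let ?s = "\<lambda>k. sphere_proj J (u k)"
  have "(\<Sum>k\<in>K. \<Sum>l\<in>K. c k * c l * Fstar 3 (\<Sum>j\<in>J. u k j * u l j))
      = (\<Sum>k\<in>K. \<Sum>l\<in>K. c k * c l * (\<integral>Z. (\<Sum>i<3. ?s k Z i * ?s l Z i) \<partial>?G))"
    using assms by (simp add: integral_sphere_proj)
  also have "\<dots> = (\<integral>Z. (\<Sum>k\<in>K. \<Sum>l\<in>K. c k * c l * (\<Sum>i<3. ?s k Z i * ?s l Z i)) \<partial>?G)"
  proof -
    have int: "integrable ?G (\<lambda>Z. c k * c l * (\<Sum>i<3. ?s k Z i * ?s l Z i))" for k l
      by (intro integrable_mult_right Bochner_Integration.integrable_sum integrable_sphere_proj) simp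
    have "(\<integral>Z. (\<Sum>k\<in>K. \<Sum>l\<in>K. c k * c l * (\<Sum>i<3. ?s k Z i * ?s l Z i)) \<partial>?G)
        = (\<Sum>k\<in>K. \<integral>Z. (\<Sum>l\<in>K. c k * c l * (\<Sum>i<3. ?s k Z i * ?s l Z i)) \<partial>?G)"
      by (intro Bochner_Integration.integral_sum Bochner_Integration.integrable_sum int)
    also have "\<dots> = (\<Sum>k\<in>K. \<Sum>l\<in>K. \<integral>Z. c k * c l * (\<Sum>i<3. ?s k Z i * ?s l Z i) \<partial>?G)"
      by (intro sum.cong refl Bochner_Integration.integral_sum int)
    finally show ?thesis by simp
  qed
  also have "\<dots> = (\<integral>Z. (\<Sum>i<3. (\<Sum>k\<in>K. c k * ?s k Z i)\<^sup>2) \<partial>?G)"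
  proof (intro Bochner_Integration.integral_cong refl)
    fix Z
    have "(\<Sum>k\<in>K. \<Sum>l\<in>K. c k * c l * (\<Sum>i<3. ?s k Z i * ?s l Z i))
       = (\<Sum>k\<in>K. \<Sum>i<3. \<Sum>l\<in>K. (c k * ?s k Z i) * (c l * ?s l Z i))"
      by (subst sum.swap[of _ K]) (simp add: sum_distrib_left mult_ac)
    also have "\<dots> = (\<Sum>i<3. (\<Sum>k\<in>K. c k * ?s k Z i)\<^sup>2)"
      by (subst sum.swap) (simp add: power2_eq_square sum_product)
    finally show "(\<Sum>k\<in>K. \<Sum>l\<in>K. c k * c l * (\<Sum>i<3. ?s k Z i * ?s l Z i)) = \<dots>" .
  qed
  also have "\<dots> \<ge> 0" by (intro Bochner_Integration.integral_nonneg sum_nonneg) simp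
  finally show ?thesis .
qed

text \<open>Positive definiteness tested on a hub, vector 0, of weight t and m spokes of weight -c.
  The opposite signs put the hub-spoke terms on the other side of the inequality; the m + 1 diagonal
  values are bounded by 1.\<close>

lemma Fstar3_hub_le:
  fixes u :: "nat \<Rightarrow> nat \<Rightarrow> real"
  assumes J: "finite J" and u: "\<And>k. k \<le> m \<Longrightarrow> (\<Sum>j\<in>J. (u k j)\<^sup>2) = 1"
    and r: "\<And>k. 1 \<le> k \<Longrightarrow> k \<le> m \<Longrightarrow> (\<Sum>j\<in>J. u 0 j * u k j) = r"
    and q: "\<And>k l. 1 \<le> k \<Longrightarrow> k \<le> m \<Longrightarrow> 1 \<le> l \<Longrightarrow> l \<le> m \<Longrightarrow> k \<noteq> l \<Longrightarrow> (\<Sum>j\<in>J. u k j * u l j) = q"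
  shows "2 * real m * c * t * Fstar 3 r \<le> t\<^sup>2 + real m * c\<^sup>2 + real m * (real m - 1) * c\<^sup>2 * Fstar 3 q"
proof -
  let ?F = "\<lambda>k l. Fstar 3 (\<Sum>j\<in>J. u k j * u l j)"
  have diag: "?F k k \<le> 1" if "k \<le> m" for k
    using u[OF that] Fstar3_le_1[of 1] by (simp add: power2_eq_square)
  have row: "(\<Sum>l=1..m. ?F k l) \<le> 1 + (real m - 1) * Fstar 3 q" if k: "k \<in> {1..m}" for k
  proof -
    have "(\<Sum>l=1..m. ?F k l) = ?F k k + (\<Sum>l\<in>{1..m} - {k}. ?F k l)"
      using k by (intro sum.remove) auto
    also have "(\<Sum>l\<in>{1..m} - {k}. ?F k l) = (\<Sum>l\<in>{1..m} - {k}. Fstar 3 q)"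
      using k by (intro sum.cong refl arg_cong[where f = "Fstar 3"] q) auto
    also have "\<dots> = (real m - 1) * Fstar 3 q" using k by (simp add: of_nat_diff)
    finally show ?thesis using diag[of k] k by simp
  qed
  define d where "d = (\<lambda>k::nat. if k = 0 then t else - c)"
  have "0 \<le> (\<Sum>k\<in>insert 0 {1..m}. \<Sum>l\<in>insert 0 {1..m}. d k * d l * ?F k l)"
    using J u by (intro Fstar3_positive_definite) auto
  also have "\<dots> = t\<^sup>2 * ?F 0 0 - t * c * (\<Sum>l=1..m. ?F 0 l) - t * c * (\<Sum>k=1..m. ?F k 0) + c\<^sup>2 * (\<Sum>k=1..m. \<Sum>l=1..m. ?F k l)"
    by (simp add: d_def sum.distrib sum_distrib_left sum_negf power2_eq_square mult_ac sum_subtractf)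
  also have "(\<Sum>l=1..m. ?F 0 l) = (\<Sum>l=1..m. Fstar 3 r)"
    by (intro sum.cong refl arg_cong[where f = "Fstar 3"] r) auto
  also have "(\<Sum>k=1..m. ?F k 0) = (\<Sum>k=1..m. Fstar 3 r)"
    by (intro sum.cong refl arg_cong[where f = "Fstar 3"], subst mult.commute, rule r) auto
  finally have "0 \<le> t\<^sup>2 * ?F 0 0 - 2 * real m * c * t * Fstar 3 r + c\<^sup>2 * (\<Sum>k=1..m. \<Sum>l=1..m. ?F k l)"
    by (simp add: algebra_simps)
  moreover have "t\<^sup>2 * ?F 0 0 \<le> t\<^sup>2 * 1"
    using diag[of 0] by (intro mult_left_mono) auto
  moreover have "c\<^sup>2 * (\<Sum>k=1..m. \<Sum>l=1..m. ?F k l) \<le> c\<^sup>2 * (\<Sum>k=1..m. 1 + (real m - 1) * Fstar 3 q)"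
    using row by (intro mult_left_mono sum_mono) auto
  ultimately show ?thesis by (simp add: algebra_simps)
qed

lemma sum_atMost_split_0: "(\<Sum>j\<le>m. f j) = f 0 + (\<Sum>j=1..m. f j)" for f :: "nat \<Rightarrow> real"
proof -
  have "{..m} = insert 0 {1..m}" by auto
  then show ?thesis by simp
qed

text \<open>The spokes are orthonormal, so their mutual terms vanish with F(0), and the hub has
  component r along each. This requires m r^2 \<le> 1; coordinate 0 of the hub takes up the missing
  length. The weights 1 and 1 / sqrt m give the hub and all spokes together equal diagonal
  contributions.\<close>

lemma Fstar3_le_inverse_sqrt:
  assumes m: "m \<ge> 1" "real m * r\<^sup>2 \<le> 1"
  shows "Fstar 3 r \<le> 1 / sqrt m"
proof -
  define u where "u = (\<lambda>k j :: nat. if k = 0 then (if j = 0 then sqrt (1 - real m * r\<^sup>2) else r) else (if j = k then 1 else 0))"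
  have "2 * real m * (1 / sqrt m) * 1 * Fstar 3 r \<le> 1\<^sup>2 + real m * (1 / sqrt m)\<^sup>2 + real m * (real m - 1) * (1 / sqrt m)\<^sup>2 * Fstar 3 0"
  proof (rule Fstar3_hub_le[where J = "{..m}" and u = u])
    fix k assume "k \<le> m"
    then show "(\<Sum>j\<le>m. (u k j)\<^sup>2) = 1"
      using m by (cases "k = 0") (simp_all add: u_def sum_atMost_split_0 if_distrib[of "\<lambda>x. x\<^sup>2"] cong: if_cong)
  next
    fix k assume "1 \<le> k" "k \<le> m"
    then show "(\<Sum>j\<le>m. u 0 j * u k j) = r"
      by (simp add: u_def if_distrib[of "\<lambda>x. _ * x"] cong: if_cong)
  next
    fix k l assume "1 \<le> k" "k \<le> m" "1 \<le> l" "l \<le> m" "k \<noteq> l"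
    then show "(\<Sum>j\<le>m. u k j * u l j) = 0"
      by (intro sum.neutral) (auto simp: u_def)
  qed simp
  moreover have "real m * (1 / sqrt m)\<^sup>2 = 1" "real m * (1 / sqrt m) = sqrt m"
    using m by (simp_all add: power_divide real_div_sqrt)
  moreover have "2 * real m * (1 / sqrt m) * 1 * Fstar 3 r = 2 * (real m * (1 / sqrt m)) * Fstar 3 r" by simp
  ultimately have "2 * sqrt m * Fstar 3 r \<le> 2"
    by (simp only: Fstar3_0) simp
  then show ?thesis using m by (simp add: field_simps)
qed

lemma Fstar3_le_double:
  assumes "0 < r" "r \<le> 1"
  shows "Fstar 3 r \<le> 2 * r"
proof -
  \<comment> \<open>The largest m with m r^2 \<le> 1. It satisfies 1 / r^2 < m + 1 \<le> 4 m, and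
    the factor 4 has the root 2.\<close>
  define m where "m = nat \<lfloor>1 / r\<^sup>2\<rfloor>"
  have r2: "0 < r\<^sup>2" "r\<^sup>2 \<le> 1" using assms by (auto simp: power_le_one)
  then have "1 \<le> 1 / r\<^sup>2" by simp
  then have m: "m \<ge> 1" "real m \<le> 1 / r\<^sup>2" "1 / r\<^sup>2 < real m + 1"
    by (auto simp: m_def le_nat_iff)
  have "Fstar 3 r \<le> 1 / sqrt m"
    using m r2 by (intro Fstar3_le_inverse_sqrt) (auto simp: field_simps)
  also have "1 / r\<^sup>2 \<le> 4 * real m" using m by linarith
  then have "sqrt (1 / r\<^sup>2) \<le> sqrt (4 * real m)" by (rule real_sqrt_le_mono)
  then have "1 / r \<le> 2 * sqrt m" using assms by (simp add: real_sqrt_divide real_sqrt_mult)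
  then have "1 / sqrt m \<le> 2 * r" using m assms by (simp add: field_simps)
  finally show ?thesis .
qed

text \<open>Spokes that share only their component r along the hub have mutual inner product r^2.
  With t = F(r) and c = 1 / m the hub inequality reads F(r)^2 - F(r^2) \<le> (1 - F(r^2)) / m.
  Letting m grow removes the right side; this is where spheres of every dimension enter.\<close>

lemma Fstar3_sq_le:
  assumes "0 \<le> r" "r \<le> 1"
  shows "(Fstar 3 r)\<^sup>2 \<le> Fstar 3 (r\<^sup>2)"
proof -
  have r2: "r\<^sup>2 \<le> 1" using assms by (auto simp: power_le_one)
  let ?F = "Fstar 3 r" and ?G = "Fstar 3 (r\<^sup>2)"
  have *: "?F\<^sup>2 - ?G \<le> (1 - ?G) / real m" if m: "m \<ge> 1" for m
  proof -
    define u where "u = (\<lambda>k j :: nat. if k = 0 then (if j = 0 then 1 else 0) else if j = 0 then r else if j = k then sqrt (1 - r\<^sup>2) else 0)"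
    have "2 * real m * (1 / m) * ?F * ?F \<le> ?F\<^sup>2 + real m * (1 / m)\<^sup>2 + real m * (real m - 1) * (1 / m)\<^sup>2 * ?G"
    proof (rule Fstar3_hub_le[where J = "{..m}" and u = u])
      fix k assume "k \<le> m"
      then show "(\<Sum>j\<le>m. (u k j)\<^sup>2) = 1"
        using r2 by (cases "k = 0") (simp_all add: u_def sum_atMost_split_0 if_distrib[of "\<lambda>x. x\<^sup>2"] cong: if_cong)
    next
      fix k assume "1 \<le> k" "k \<le> m"
      then show "(\<Sum>j\<le>m. u 0 j * u k j) = r"
        by (simp add: u_def sum_atMost_split_0)
    next
      fix k l assume *: "1 \<le> k" "k \<le> m" "1 \<le> l" "l \<le> m" "k \<noteq> l"
      have "(\<Sum>j=1..m. u k j * u l j) = 0"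
        using * by (intro sum.neutral) (auto simp: u_def)
      then show "(\<Sum>j\<le>m. u k j * u l j) = r\<^sup>2"
        using * by (simp add: u_def sum_atMost_split_0 power2_eq_square)
    qed simp
    also have "real m * (1 / m)\<^sup>2 = 1 / m" using m by (simp add: power2_eq_square)
    also have "real m * (real m - 1) * (1 / m)\<^sup>2 = 1 - 1 / m" using m by (simp add: power2_eq_square field_simps)
    also have "2 * real m * (1 / m) = 2" using m by simp
    finally show ?thesis by (simp add: power2_eq_square algebra_simps diff_divide_distrib)
  qed
  have "(\<lambda>m. (1 - ?G) / real m) \<longlonglongrightarrow> 0" by real_asymp
  then have "?F\<^sup>2 - ?G \<le> 0"
    using * by (intro LIMSEQ_le_const) (auto intro: exI[of _ 1])
  then show ?thesis by simp
qed

text \<open>If \<open>F(r) = \<kappa> r\<close> with \<open>\<kappa> > 1\<close>, iterating \<open>F(r)\<^sup>2 \<le> F(r\<^sup>2)\<close> makes \<open>F(s) / s\<close> unbounded as \<open>s \<rightarrow> 0\<close>.\<close>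
lemma Fstar3_le_self:
  assumes "0 \<le> r" "r \<le> 1"
  shows "Fstar 3 r \<le> r"
proof (rule ccontr)
  assume "\<not> Fstar 3 r \<le> r"
  then have gt: "Fstar 3 r > r" by simp
  then have r: "r > 0" using assms Fstar3_0 by (cases "r = 0") auto
  define \<kappa> where "\<kappa> = Fstar 3 r / r"
  have \<kappa>: "\<kappa> > 1" using gt r by (simp add: \<kappa>_def)
  \<comment> \<open>Each step squares both sides, which is monotone because F(r) > r > 0.\<close>
  have pow: "(Fstar 3 r) ^ (2 ^ k) \<le> Fstar 3 (r ^ (2 ^ k))" for k
  proof (induction k)
    case (Suc k)
    have "(Fstar 3 r) ^ (2 ^ Suc k) = ((Fstar 3 r) ^ (2 ^ k))\<^sup>2"
      by (simp add: power_mult[symmetric] mult.commute)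
    also have "\<dots> \<le> (Fstar 3 (r ^ (2 ^ k)))\<^sup>2"
      using Suc gt r by (intro power_mono) auto
    also have "\<dots> \<le> Fstar 3 ((r ^ (2 ^ k))\<^sup>2)"
      using assms by (intro Fstar3_sq_le) (auto simp: power_le_one)
    also have "(r ^ (2 ^ k))\<^sup>2 = r ^ (2 ^ Suc k)"
      by (simp add: power_mult[symmetric] mult.commute)
    finally show ?case .
  qed simp
  \<comment> \<open>This is F(s) \<le> 2 s at s = r^(2^k), divided by s.\<close>
  have "\<kappa> ^ (2 ^ k) \<le> 2" for k
  proof -
    have "(Fstar 3 r) ^ (2 ^ k) \<le> 2 * r ^ (2 ^ k)"
      using pow[of k] Fstar3_le_double[of "r ^ (2 ^ k)"] r assms by (simp add: power_le_one)
    then show ?thesis using r by (simp add: \<kappa>_def power_divide field_simps)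
  qed
  moreover obtain n where "2 < \<kappa> ^ n" using real_arch_pow[OF \<kappa>] by blast
  moreover have "\<kappa> ^ n \<le> \<kappa> ^ (2 ^ n)"
    using \<kappa> by (intro power_increasing) (auto intro: less_imp_le[OF less_exp])
  ultimately show False by (metis not_less order_trans)
qed

section \<open>Rounding semidefinite solutions\<close>

lemma weighted_graphD:
  assumes "weighted_graph N w"
  shows "i < j \<Longrightarrow> j < N \<Longrightarrow> w i j \<ge> 0" "(\<Sum>j<N. \<Sum>i<j. w i j) = 1"
  using assms by (auto simp: weighted_graph_def)

lemma edge_obj_mono:
  assumes "weighted_graph N w" "\<And>i j. i < j \<Longrightarrow> j < N \<Longrightarrow> c * (1 - ip i j) \<le> 1 - ip' i j"
  shows "c * edge_obj N w ip \<le> edge_obj N w ip'"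
  unfolding edge_obj_def sum_distrib_left
proof (intro sum_mono)
  fix i j assume "j \<in> {..<N}" "i \<in> {..<j}"
  then have "w i j * (c * (1 - ip i j)) \<le> w i j * (1 - ip' i j)"
    using assms by (intro mult_left_mono weighted_graphD(1)[OF assms(1)]) auto
  then show "c * (w i j * (1/4 - 1/4 * ip i j)) \<le> w i j * (1/4 - 1/4 * ip' i j)"
    by (simp add: algebra_simps)
qed

lemma edge_obj_const: "weighted_graph N w \<Longrightarrow> edge_obj N w (\<lambda>_ _. c) = (1 - c) / 4"
  using weighted_graphD(2)[of N w]
  unfolding edge_obj_def sum_distrib_right[symmetric] by simp

lemma edge_obj_le_half:
  assumes "weighted_graph N w" "\<And>i j. i < j \<Longrightarrow> j < N \<Longrightarrow> -1 \<le> ip i j"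
  shows "edge_obj N w ip \<le> 1/2"
  using edge_obj_mono[OF assms(1), of 1 ip "\<lambda>_ _. -1"] assms(2)
  by (simp add: edge_obj_const[OF assms(1)])

text \<open>A real \<open>SUP\<close> bounds its members only over a set bounded above; 1/2 is a
  bound because inner products of unit vectors are at least -1.\<close>

lemma ProdG_upper:
  assumes w: "weighted_graph N w" and f: "\<And>i. i < N \<Longrightarrow> norm (f i :: real^3) = 1"
  shows "edge_obj N w (\<lambda>i j. inner (f i) (f j)) \<le> ProdG N w"
  unfolding ProdG_def
proof (rule cSUP_upper)
  show "bdd_above ((\<lambda>f. edge_obj N w (\<lambda>i j. inner (f i) (f j))) ` {f :: nat \<Rightarrow> real^3. \<forall>i<N. f i \<in> sphere 0 1})"
  proof (rule bdd_aboveI2)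
    fix f :: "nat \<Rightarrow> real^3" assume f: "f \<in> {f. \<forall>i<N. f i \<in> sphere 0 1}"
    show "edge_obj N w (\<lambda>i j. inner (f i) (f j)) \<le> 1/2"
    proof (rule edge_obj_le_half[OF w])
      fix i j :: nat assume "i < j" "j < N"
      then show "-1 \<le> inner (f i) (f j)"
        using Cauchy_Schwarz_ineq2[of "f i" "f j"] f by (simp add: abs_le_iff)
    qed
  qed
qed (use f in simp)

lemma SDP_Prod_upper:
  assumes w: "weighted_graph N w" and f: "\<And>i. i < N \<Longrightarrow> (\<Sum>k<N. (f i k)\<^sup>2) = 1"
  shows "edge_obj N w (\<lambda>i j. \<Sum>k<N. f i k * f j k) \<le> SDP_Prod N w"
  unfolding SDP_Prod_def
proof (rule cSUP_upper)
  show "bdd_above ((\<lambda>f. edge_obj N w (\<lambda>i j. \<Sum>k<N. f i k * f j k)) ` {f. \<forall>i<N. (\<Sum>k<N. (f i k)\<^sup>2) = 1})"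
  proof (rule bdd_aboveI2)
    fix f :: "nat \<Rightarrow> nat \<Rightarrow> real" assume f: "f \<in> {f. \<forall>i<N. (\<Sum>k<N. (f i k)\<^sup>2) = 1}"
    show "edge_obj N w (\<lambda>i j. \<Sum>k<N. f i k * f j k) \<le> 1/2"
    proof (rule edge_obj_le_half[OF w])
      fix i j :: nat assume "i < j" "j < N"
      then show "-1 \<le> (\<Sum>k<N. f i k * f j k)"
        using abs_sum_mult_le_1[of "f i" "{..<N}" "f j"] f by (simp add: abs_le_iff)
    qed
  qed
qed (use f in simp)

text \<open>The standard basis is feasible and makes every edge inner product 0, hence has value
  1/4. This makes the ratio meaningful for every graph.\<close>

lemma SDP_Prod_pos:
  assumes w: "weighted_graph N w"
  shows "SDP_Prod N w > 0"
proof -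
  let ?f = "\<lambda>i k :: nat. if i = k then 1 else 0 :: real"
  have "edge_obj N w (\<lambda>i j. \<Sum>k<N. ?f i k * ?f j k) \<le> SDP_Prod N w"
    using w by (rule SDP_Prod_upper) (simp add: if_distrib[of "\<lambda>x. x\<^sup>2"] cong: if_cong)
  moreover have "edge_obj N w (\<lambda>i j. \<Sum>k<N. ?f i k * ?f j k) = edge_obj N w (\<lambda>_ _. 0)"
    unfolding edge_obj_def by (intro sum.cong refl) (simp add: sum.neutral)
  ultimately show ?thesis by (simp add: edge_obj_const[OF w])
qed

lemma AE_corr_normal_fst_nonzero: "AE p in corr_normal \<rho>. fst p \<noteq> 0"
proof -
  interpret prob_space std_normal by (rule prob_space_std_normal)
  interpret pair_prob_space std_normal std_normal ..
  have "AE x in std_normal. x \<noteq> 0"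
    by (simp add: AE_density) (use AE_lborel_singleton[of "0::real"] in eventually_elim, simp)
  moreover have "{p \<in> space (std_normal \<Otimes>\<^sub>M std_normal). fst p \<noteq> 0} \<in> sets (std_normal \<Otimes>\<^sub>M std_normal)"
  proof -
    have "fst -` (- {0}) \<inter> space (std_normal \<Otimes>\<^sub>M std_normal) \<in> sets (std_normal \<Otimes>\<^sub>M std_normal)"
      by (rule measurable_sets[OF measurable_fst]) simp
    then show ?thesis by (simp add: vimage_def Int_def conj_commute)
  qed
  ultimately have "AE p in std_normal \<Otimes>\<^sub>M std_normal. fst p \<noteq> 0"
    by (intro AE_pair_measure) simp_all
  then show ?thesis
    unfolding corr_normal_def by (subst AE_distr_iff) (auto simp: case_prod_beta)
qed

text \<open>Za can vanish only if its row-0 entry does, and that entry is a standard normal, hence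
  almost surely nonzero.\<close>

lemma AE_sphere_proj_unit:
  assumes J: "finite J" "(\<Sum>j\<in>J. (a j)\<^sup>2) = 1"
  shows "AE Z in gauss_on ({..<3::nat} \<times> J). (\<Sum>i<3. (sphere_proj J a Z i)\<^sup>2) = 1"
proof -
  let ?K = "{..<3::nat} \<times> J"
  \<comment> \<open>The row-0 entry as a linear form in all entries of Z. Its coefficient vector is
    a unit vector; paired with itself it falls under the law of pairs.\<close>
  define b where "b k = (if fst k = 0 then a (snd k) else 0)" for k :: "nat \<times> _"
  have b: "(\<Sum>k\<in>?K. (b k)\<^sup>2) = 1"
    using J(2) by (simp add: sum.cartesian_product' b_def lessThan_Suc numeral_3_eq_3)
  have "AE Z in gauss_on ?K. (\<Sum>k\<in>?K. Z k * b k) \<noteq> 0"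
    using AE_corr_normal_fst_nonzero[of "\<Sum>k\<in>?K. b k * b k"] J b
    by (subst (asm) distr_gauss_on_pair[symmetric]) (auto simp: AE_distr_iff)
  then show ?thesis
  proof eventually_elim
    fix Z assume "(\<Sum>k\<in>?K. Z k * b k) \<noteq> 0"
    then have nz: "(\<Sum>j\<in>J. Z (0, j) * a j) \<noteq> 0"
      by (simp add: sum.cartesian_product' b_def lessThan_Suc numeral_3_eq_3)
    define x where "x = (\<lambda>i::nat. \<Sum>j\<in>J. Z (i, j) * a j)"
    have "(\<Sum>i<3. (x i)\<^sup>2) > 0"
      using nz by (intro sum_pos2[of _ 0]) (auto simp: x_def)
    then have "(\<Sum>i<3. (x i / sqrt (\<Sum>i<3. (x i)\<^sup>2))\<^sup>2) = 1"
      by (simp add: power_divide flip: sum_divide_distrib)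
    then show "(\<Sum>i<3. (sphere_proj J a Z i)\<^sup>2) = 1"
      by (simp add: sphere_proj_def x_def)
  qed
qed

text \<open>Averaging: one matrix Z rounds all vertices at once, and the mean value of the random
  solution cannot exceed the supremum over solutions in the sphere.\<close>

lemma ProdG_ge_rounding:
  assumes w: "weighted_graph N w" and f: "\<And>i. i < N \<Longrightarrow> (\<Sum>k<N. (f i k)\<^sup>2) = 1"
  shows "edge_obj N w (\<lambda>i j. Fstar 3 (\<Sum>k<N. f i k * f j k)) \<le> ProdG N w"
proof -
  let ?G = "gauss_on ({..<3::nat} \<times> {..<N})"
  let ?s = "\<lambda>i. sphere_proj {..<N} (f i)"
  interpret prob_space ?G by (rule prob_space_gauss_on)
  have int: "integrable ?G (\<lambda>Z. w i j * (1/4 - 1/4 * (\<Sum>c<3. ?s i Z c * ?s j Z c)))" for i j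
    by (intro integrable_mult_right Bochner_Integration.integrable_diff integrable_const
        Bochner_Integration.integrable_sum integrable_sphere_proj) simp
  have int2: "integrable ?G (\<lambda>Z. \<Sum>c<3. ?s i Z c * ?s j Z c)" for i j
    by (intro Bochner_Integration.integrable_sum integrable_sphere_proj) simp
  have "(\<integral>Z. edge_obj N w (\<lambda>i j. \<Sum>c<3. ?s i Z c * ?s j Z c) \<partial>?G)
      = (\<Sum>j<N. \<integral>Z. (\<Sum>i<j. w i j * (1/4 - 1/4 * (\<Sum>c<3. ?s i Z c * ?s j Z c))) \<partial>?G)"
    unfolding edge_obj_def
    by (intro Bochner_Integration.integral_sum Bochner_Integration.integrable_sum int)
  also have "\<dots> = (\<Sum>j<N. \<Sum>i<j. \<integral>Z. w i j * (1/4 - 1/4 * (\<Sum>c<3. ?s i Z c * ?s j Z c)) \<partial>?G)"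
    by (intro sum.cong refl Bochner_Integration.integral_sum int)
  also have "\<dots> = edge_obj N w (\<lambda>i j. Fstar 3 (\<Sum>k<N. f i k * f j k))"
    unfolding edge_obj_def
  proof (intro sum.cong refl)
    fix i j assume "j \<in> {..<N}" "i \<in> {..<j}"
    then have "(\<integral>Z. (\<Sum>c<3. ?s i Z c * ?s j Z c) \<partial>?G) = Fstar 3 (\<Sum>k<N. f i k * f j k)"
      by (intro integral_sphere_proj f) auto
    then show "(\<integral>Z. w i j * (1/4 - 1/4 * (\<Sum>c<3. ?s i Z c * ?s j Z c)) \<partial>?G)
       = w i j * (1/4 - 1/4 * Fstar 3 (\<Sum>k<N. f i k * f j k))"
      using Bochner_Integration.integral_diff[OF integrable_const[of "1/4"] integrable_mult_right[OF int2, of "1/4"], of i j]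
      by (simp add: prob_space)
  qed
  finally have eq: "edge_obj N w (\<lambda>i j. Fstar 3 (\<Sum>k<N. f i k * f j k))
      = (\<integral>Z. edge_obj N w (\<lambda>i j. \<Sum>c<3. ?s i Z c * ?s j Z c) \<partial>?G)" ..
  \<comment> \<open>On a null set some vertex may be rounded to 0, which is not feasible; off it
    every vertex receives a unit vector.\<close>
  have "AE Z in ?G. \<forall>i\<in>{..<N}. (\<Sum>c<3. (?s i Z c)\<^sup>2) = 1"
    using f by (intro AE_finite_allI AE_sphere_proj_unit) auto
  then have "AE Z in ?G. edge_obj N w (\<lambda>i j. \<Sum>c<3. ?s i Z c * ?s j Z c) \<le> ProdG N w"
  proof eventually_elim
    fix Z assume unit: "\<forall>i\<in>{..<N}. (\<Sum>c<3. (?s i Z c)\<^sup>2) = 1"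
    define g where "g i = (vector [?s i Z 0, ?s i Z 1, ?s i Z 2] :: real^3)" for i
    have inner_g: "inner (g i) (g j) = (\<Sum>c<3. ?s i Z c * ?s j Z c)" for i j
      by (simp add: g_def inner_vec_def sum_3 eval_nat_numeral)
    have "edge_obj N w (\<lambda>i j. inner (g i) (g j)) \<le> ProdG N w"
    proof (rule ProdG_upper[OF w])
      fix i assume "i < N"
      then show "norm (g i) = 1"
        using unit by (simp add: norm_eq_1 inner_g power2_eq_square)
    qed
    then show "edge_obj N w (\<lambda>i j. \<Sum>c<3. ?s i Z c * ?s j Z c) \<le> ProdG N w"
      by (simp only: inner_g)
  qed
  then show ?thesis
    unfolding eq unfolding edge_obj_def
    by (intro integral_le_const Bochner_Integration.integrable_sum int)
qed

text \<open>The product form also covers \<rho> = 1, which lies outside the range of the infimum but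
  occurs when an SDP solution puts both ends of an edge at the same point.\<close>

lemma alpha_BOV_lower:
  assumes "-1 \<le> \<rho>" "\<rho> \<le> 1"
  shows "alpha_BOV * (1 - \<rho>) \<le> 1 - Fstar 3 \<rho>"
proof (cases "\<rho> = 1")
  case False
  have "alpha_BOV \<le> (1 - Fstar 3 \<rho>) / (1 - \<rho>)"
    unfolding alpha_BOV_def using assms False
    by (intro cINF_lower bdd_belowI2[of _ 0]) (auto intro!: divide_nonneg_nonneg Fstar3_le_1)
  then show ?thesis using assms False by (simp add: field_simps)
qed (use Fstar3_le_1[of 1] in simp)

lemma alpha_BOV_nonneg: "alpha_BOV \<ge> 0"
  unfolding alpha_BOV_def by (intro cINF_greatest) (auto intro!: divide_nonneg_nonneg Fstar3_le_1)

lemma alpha_BOV_le_ratio: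
  assumes w: "weighted_graph N w"
  shows "alpha_BOV \<le> ProdG N w / SDP_Prod N w"
proof -
  have *: "alpha_BOV * edge_obj N w (\<lambda>i j. \<Sum>k<N. f i k * f j k) \<le> ProdG N w"
    if f: "\<And>i. i < N \<Longrightarrow> (\<Sum>k<N. (f i k)\<^sup>2) = 1" for f :: "nat \<Rightarrow> nat \<Rightarrow> real"
  proof -
    have "alpha_BOV * edge_obj N w (\<lambda>i j. \<Sum>k<N. f i k * f j k) \<le> edge_obj N w (\<lambda>i j. Fstar 3 (\<Sum>k<N. f i k * f j k))"
    proof (rule edge_obj_mono[OF w], rule alpha_BOV_lower)
      fix i j :: nat assume "i < j" "j < N"
      then have "\<bar>\<Sum>k<N. f i k * f j k\<bar> \<le> 1" using f by (intro abs_sum_mult_le_1) auto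
      then show "-1 \<le> (\<Sum>k<N. f i k * f j k)" "(\<Sum>k<N. f i k * f j k) \<le> 1" by (auto simp: abs_le_iff)
    qed
    also have "\<dots> \<le> ProdG N w" by (rule ProdG_ge_rounding[OF w f])
    finally show ?thesis .
  qed
  have unit: "(\<Sum>k<N. (if i = k then 1 else 0 :: real)\<^sup>2) = 1" if "i < N" for i
    using that by (simp add: if_distrib[of "\<lambda>x. x\<^sup>2"] cong: if_cong)
  \<comment> \<open>Moving the factor past the supremum means dividing by it, so a zero factor is
    treated apart: there \<open>*\<close> at the standard basis yields
    \<open>0 \<le> ProdG N w\<close>.\<close>
  have "alpha_BOV * SDP_Prod N w \<le> ProdG N w"
  proof (cases "alpha_BOV = 0")
    case True
    then show ?thesis using *[OF unit] by simp
  next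
    case False
    then have pos: "alpha_BOV > 0" using alpha_BOV_nonneg by simp
    have "SDP_Prod N w \<le> ProdG N w / alpha_BOV"
      unfolding SDP_Prod_def
    proof (rule cSUP_least)
      show "{f :: nat \<Rightarrow> nat \<Rightarrow> real. \<forall>i<N. (\<Sum>k<N. (f i k)\<^sup>2) = 1} \<noteq> {}"
        using unit by (auto intro!: exI[of _ "\<lambda>i k. if i = k then 1 else 0"])
    qed (use * pos in \<open>simp add: field_simps\<close>)
    then show ?thesis using pos by (simp add: field_simps)
  qed
  then show ?thesis using SDP_Prod_pos[OF w] by (simp add: field_simps)
qed

section \<open>The Gaussian graph\<close>

lemma space_gauss: "space (gauss n) = extensional {..<n}"
  by (simp add: gauss_def space_gauss_on)

lemma sets_gauss [measurable_cong]: "sets (gauss n) = sets (PiM {..<n} (\<lambda>_. borel))"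
  by (simp add: gauss_def sets_gauss_on)

lemma prob_space_gauss: "prob_space (gauss n)"
  unfolding gauss_def by (rule prob_space_gauss_on)

lemma measurable_gauss_component [measurable]:
  "i \<in> I \<Longrightarrow> (\<lambda>x. x i) \<in> borel_measurable (gauss_on I)"
  by measurable

text \<open>Stability integrates over two independent vectors, whereas the laws above concern one
  Gaussian matrix; making the vectors its two columns passes from one to the other.\<close>

lemma measurable_merge_columns:
  "(\<lambda>p. \<lambda>k\<in>I \<times> {..<2::nat}. if snd k = 0 then fst p (fst k) else snd p (fst k))
    \<in> gauss_on I \<Otimes>\<^sub>M gauss_on I \<rightarrow>\<^sub>M gauss_on (I \<times> {..<2})"
proof -
  have "(\<lambda>p. if snd k = 0 then fst p (fst k) else snd p (fst k)) \<in> borel_measurable (gauss_on I \<Otimes>\<^sub>M gauss_on I)"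
    if "k \<in> I \<times> {..<2::nat}" for k
    using that by (cases "snd k = 0") (auto intro!: measurable_compose[OF measurable_fst] measurable_compose[OF measurable_snd])
  then have "(\<lambda>p. \<lambda>k\<in>I \<times> {..<2::nat}. if snd k = 0 then fst p (fst k) else snd p (fst k))
      \<in> gauss_on I \<Otimes>\<^sub>M gauss_on I \<rightarrow>\<^sub>M PiM (I \<times> {..<2}) (\<lambda>_. borel)"
    by (rule measurable_restrict)
  then show ?thesis by (simp cong: measurable_cong_sets add: sets_gauss_on)
qed

text \<open>Boxes determine a product measure, and a box of two-column matrices is the product of a
  box for each column.\<close>

lemma gauss_on_eq_distr_pair:
  assumes "finite I"
  shows "distr (gauss_on I \<Otimes>\<^sub>M gauss_on I) (gauss_on (I \<times> {..<2::nat}))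
      (\<lambda>p. \<lambda>k\<in>I \<times> {..<2}. if snd k = 0 then fst p (fst k) else snd p (fst k)) = gauss_on (I \<times> {..<2})"
    (is "distr ?P ?G ?m = ?G")
proof -
  interpret product_prob_space "\<lambda>_. std_normal" "I \<times> {..<2::nat}"
    by (rule product_prob_spaceI) (rule prob_space_std_normal)
  interpret G: prob_space "gauss_on I" by (rule prob_space_gauss_on)
  have [measurable]: "?m \<in> ?P \<rightarrow>\<^sub>M ?G"
    by (rule measurable_merge_columns)
  have "distr ?P ?G ?m = PiM (I \<times> {..<2::nat}) (\<lambda>_. std_normal)"
  proof (rule PiM_eqI)
    show "finite (I \<times> {..<2::nat})" using assms by simp
    show "sets (distr ?P ?G ?m) = sets (PiM (I \<times> {..<2::nat}) (\<lambda>_. std_normal))"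
      by (simp add: gauss_on_def)
    fix A :: "'a \<times> nat \<Rightarrow> real set"
    assume A: "\<And>k. k \<in> I \<times> {..<2} \<Longrightarrow> A k \<in> sets std_normal"
    have A': "(PiE I (\<lambda>i. A (i, j))) \<in> sets (gauss_on I)" if "j < 2" for j
      using A that assms unfolding gauss_on_def by (intro sets_PiM_I_finite) auto
    have "emeasure (distr ?P ?G ?m) (PiE (I \<times> {..<2}) A) = emeasure ?P (?m -` PiE (I \<times> {..<2}) A \<inter> space ?P)"
    proof (intro emeasure_distr measurable_merge_columns)
      show "PiE (I \<times> {..<2}) A \<in> sets ?G"
        using A assms unfolding gauss_on_def by (intro sets_PiM_I_finite) auto
    qed
    also have "?m -` PiE (I \<times> {..<2}) A \<inter> space ?P = PiE I (\<lambda>i. A (i, 0)) \<times> PiE I (\<lambda>i. A (i, 1))"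
    proof (intro set_eqI iffI)
      fix p assume p: "p \<in> ?m -` PiE (I \<times> {..<2}) A \<inter> space ?P"
      then have "fst p \<in> extensional I" "snd p \<in> extensional I"
        by (auto simp: space_pair_measure space_gauss_on)
      moreover have "(if j = 0 then fst p i else snd p i) \<in> A (i, j)" if "i \<in> I" "j < 2" for i j
        using p that PiE_mem[of "?m p" "I \<times> {..<2}" A "(i, j)"] by (auto split: if_splits)
      from this[of _ 0] this[of _ 1] have "\<forall>i\<in>I. fst p i \<in> A (i, 0)" "\<forall>i\<in>I. snd p i \<in> A (i, 1)"
        by simp_all
      ultimately show "p \<in> PiE I (\<lambda>i. A (i, 0)) \<times> PiE I (\<lambda>i. A (i, 1))"
        by (simp add: mem_Times_iff PiE_iff)
    qed (auto simp: space_pair_measure space_gauss_on PiE_iff less_2_cases_iff)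
    also have "emeasure ?P \<dots> = emeasure (gauss_on I) (PiE I (\<lambda>i. A (i, 0))) * emeasure (gauss_on I) (PiE I (\<lambda>i. A (i, 1)))"
      by (intro G.emeasure_pair_measure_Times A') simp_all
    also have "\<dots> = (\<Prod>i\<in>I. emeasure std_normal (A (i, 0))) * (\<Prod>i\<in>I. emeasure std_normal (A (i, 1)))"
    proof -
      interpret I: product_prob_space "\<lambda>_. std_normal" I
        by (rule product_prob_spaceI) (rule prob_space_std_normal)
      show ?thesis using A assms unfolding gauss_on_def
        by (subst (1 2) I.emeasure_PiM) auto
    qed
    also have "\<dots> = (\<Prod>k\<in>I \<times> {..<2}. emeasure std_normal (A k))"
      by (simp add: prod.cartesian_product' numeral_2_eq_2 lessThan_Suc prod.distrib mult.commute)
    finally show "emeasure (distr ?P ?G ?m) (PiE (I \<times> {..<2}) A) = (\<Prod>k\<in>I \<times> {..<2}. emeasure std_normal (A k))" .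
  qed
  then show ?thesis by (simp add: gauss_on_def)
qed

lemma sum_sq_corr_unit:
  assumes "-1 \<le> \<rho>" "\<rho> \<le> 1"
  shows "(\<Sum>j<2::nat. (if j = 0 then \<rho> else sqrt (1 - \<rho>\<^sup>2))\<^sup>2) = 1"
proof -
  have "\<rho>\<^sup>2 \<le> 1" using assms by (simp add: abs_square_le_1)
  then show ?thesis by (simp add: numeral_2_eq_2)
qed

lemma measurable_corr_partner [measurable]:
  "(\<lambda>p. corr_partner n \<rho> (fst p) (snd p)) \<in> gauss n \<Otimes>\<^sub>M gauss n \<rightarrow>\<^sub>M gauss n"
  unfolding corr_partner_def gauss_def by measurable

lemma measurable_gauss_pair_components [measurable]:
  assumes "i \<in> {..<n}"
  shows "(\<lambda>p. fst p i) \<in> borel_measurable (gauss n \<Otimes>\<^sub>M gauss n)"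
    and "(\<lambda>p. snd p i) \<in> borel_measurable (gauss n \<Otimes>\<^sub>M gauss n)"
    and "(\<lambda>p. corr_partner n \<rho> (fst p) (snd p) i) \<in> borel_measurable (gauss n \<Otimes>\<^sub>M gauss n)"
proof -
  have c: "(\<lambda>x. x i) \<in> borel_measurable (gauss n)"
    using assms unfolding gauss_def by measurable
  show "(\<lambda>p. fst p i) \<in> borel_measurable (gauss n \<Otimes>\<^sub>M gauss n)"
    by (rule measurable_compose[OF measurable_fst c])
  show "(\<lambda>p. snd p i) \<in> borel_measurable (gauss n \<Otimes>\<^sub>M gauss n)"
    by (rule measurable_compose[OF measurable_snd c])
  show "(\<lambda>p. corr_partner n \<rho> (fst p) (snd p) i) \<in> borel_measurable (gauss n \<Otimes>\<^sub>M gauss n)"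
    by (rule measurable_compose[OF measurable_corr_partner c])
qed

lemma measurable_corr_pairs:
  "(\<lambda>p. \<lambda>i\<in>{..<n}. (fst p i, corr_partner n \<rho> (fst p) (snd p) i)) \<in> gauss n \<Otimes>\<^sub>M gauss n \<rightarrow>\<^sub>M PiM {..<n} (\<lambda>_. borel \<Otimes>\<^sub>M borel)"
  "(\<lambda>p. \<lambda>i\<in>{..<n}. (corr_partner n \<rho> (fst p) (snd p) i, fst p i)) \<in> gauss n \<Otimes>\<^sub>M gauss n \<rightarrow>\<^sub>M PiM {..<n} (\<lambda>_. borel \<Otimes>\<^sub>M borel)"
  by (intro measurable_restrict measurable_Pair measurable_gauss_pair_components; assumption)+

text \<open>The matrix with columns x, z maps (1, 0) to x and (\<rho>, sqrt(1 - \<rho>^2)) to the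
  partner of x. Taking these unit vectors in the other order leaves their inner product unchanged,
  so the pair is exchangeable.\<close>

lemma distr_gauss_corr_pair:
  assumes "-1 \<le> \<rho>" "\<rho> \<le> 1" "n \<ge> 1"
  shows "distr (gauss n \<Otimes>\<^sub>M gauss n) (PiM {..<n} (\<lambda>_. borel \<Otimes>\<^sub>M borel))
      (\<lambda>p. \<lambda>i\<in>{..<n}. (fst p i, corr_partner n \<rho> (fst p) (snd p) i)) = PiM {..<n} (\<lambda>_. corr_normal \<rho>)"
    and "distr (gauss n \<Otimes>\<^sub>M gauss n) (PiM {..<n} (\<lambda>_. borel \<Otimes>\<^sub>M borel))
      (\<lambda>p. \<lambda>i\<in>{..<n}. (corr_partner n \<rho> (fst p) (snd p) i, fst p i)) = PiM {..<n} (\<lambda>_. corr_normal \<rho>)"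
proof -
  let ?u = "\<lambda>j::nat. if j = 0 then 1 else 0 :: real"
  let ?v = "\<lambda>j::nat. if j = 0 then \<rho> else sqrt (1 - \<rho>\<^sup>2)"
  let ?m = "\<lambda>p. \<lambda>k\<in>{..<n} \<times> {..<2::nat}. if snd k = 0 then fst p (fst k) else snd p (fst k)"
  let ?P = "gauss n \<Otimes>\<^sub>M gauss n"
  let ?G = "gauss_on ({..<n} \<times> {..<2::nat})"
  have uv: "(\<Sum>j<2. (?u j)\<^sup>2) = 1" "(\<Sum>j<2. (?v j)\<^sup>2) = 1" "(\<Sum>j<2. ?u j * ?v j) = \<rho>" "(\<Sum>j<2. ?v j * ?u j) = \<rho>"
    using sum_sq_corr_unit[OF assms(1,2)] by (simp_all add: numeral_2_eq_2)
  have [measurable]: "?m \<in> ?P \<rightarrow>\<^sub>M ?G" unfolding gauss_def by (rule measurable_merge_columns)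
  have *: "distr ?P (PiM {..<n} (\<lambda>_. borel \<Otimes>\<^sub>M borel))
       (\<lambda>p. \<lambda>i\<in>{..<n}. (\<Sum>j<2. ?m p (i, j) * a j, \<Sum>j<2. ?m p (i, j) * b j))
     = PiM {..<n} (\<lambda>_. corr_normal (\<Sum>j<2. a j * b j))"
    if "(\<Sum>j<2. (a j)\<^sup>2) = 1" "(\<Sum>j<2. (b j)\<^sup>2) = 1" for a b :: "nat \<Rightarrow> real"
  proof -
    have "PiM {..<n} (\<lambda>_. corr_normal (\<Sum>j<2. a j * b j))
       = distr (distr ?P ?G ?m) (PiM {..<n} (\<lambda>_. borel \<Otimes>\<^sub>M borel))
          (\<lambda>Z. \<lambda>i\<in>{..<n}. (\<Sum>j<2. Z (i, j) * a j, \<Sum>j<2. Z (i, j) * b j))"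
      using assms that gauss_on_eq_distr_pair[of "{..<n}"]
      by (subst distr_gauss_on_rows[symmetric]) (auto simp: gauss_def lessThan_empty_iff)
    also have "\<dots> = distr ?P (PiM {..<n} (\<lambda>_. borel \<Otimes>\<^sub>M borel))
         ((\<lambda>Z. \<lambda>i\<in>{..<n}. (\<Sum>j<2. Z (i, j) * a j, \<Sum>j<2. Z (i, j) * b j)) \<circ> ?m)"
      by (rule distr_distr) measurable
    finally show ?thesis by (simp add: comp_def)
  qed
  show "distr ?P (PiM {..<n} (\<lambda>_. borel \<Otimes>\<^sub>M borel))
      (\<lambda>p. \<lambda>i\<in>{..<n}. (fst p i, corr_partner n \<rho> (fst p) (snd p) i)) = PiM {..<n} (\<lambda>_. corr_normal \<rho>)"
    using *[OF uv(1,2)] unfolding uv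
    by (simp add: corr_partner_def numeral_2_eq_2 mult.commute cong: restrict_cong)
  show "distr ?P (PiM {..<n} (\<lambda>_. borel \<Otimes>\<^sub>M borel))
      (\<lambda>p. \<lambda>i\<in>{..<n}. (corr_partner n \<rho> (fst p) (snd p) i, fst p i)) = PiM {..<n} (\<lambda>_. corr_normal \<rho>)"
    using *[OF uv(2,1)] unfolding uv
    by (simp add: corr_partner_def numeral_2_eq_2 mult.commute cong: restrict_cong)
qed

lemma prob_space_gauss_pair: "prob_space (gauss n \<Otimes>\<^sub>M gauss n)"
  by (intro prob_space_pair prob_space_gauss)

lemma distr_gauss_pair_fst: "distr (gauss n \<Otimes>\<^sub>M gauss n) (gauss n) fst = gauss n"
  using prob_space_gauss by (rule prob_space.distr_pair_fst)

text \<open>By exchangeability (y, x) has the law of (x, y), so y is distributed as x.\<close>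

lemma distr_corr_partner:
  assumes "-1 \<le> \<rho>" "\<rho> \<le> 1" "n \<ge> 1"
  shows "distr (gauss n \<Otimes>\<^sub>M gauss n) (gauss n) (\<lambda>p. corr_partner n \<rho> (fst p) (snd p)) = gauss n"
proof -
  let ?P = "gauss n \<Otimes>\<^sub>M gauss n"
  let ?B = "PiM {..<n} (\<lambda>_. borel \<Otimes>\<^sub>M borel) :: (nat \<Rightarrow> real \<times> real) measure"
  let ?y = "\<lambda>p. corr_partner n \<rho> (fst p) (snd p)"
  let ?f = "\<lambda>q. \<lambda>i\<in>{..<n}. fst (q i)"
  have f: "?f \<in> ?B \<rightarrow>\<^sub>M gauss n"
    unfolding measurable_cong_sets[OF refl sets_gauss] by measurable
  have "distr ?P (gauss n) ?y = distr ?P (gauss n) (?f \<circ> (\<lambda>p. \<lambda>i\<in>{..<n}. (?y p i, fst p i)))"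
    by (intro distr_cong refl) (auto simp: corr_partner_def)
  also have "\<dots> = distr (distr ?P ?B (\<lambda>p. \<lambda>i\<in>{..<n}. (?y p i, fst p i))) (gauss n) ?f"
    by (rule distr_distr[symmetric, OF f measurable_corr_pairs(2)])
  also have "\<dots> = distr (distr ?P ?B (\<lambda>p. \<lambda>i\<in>{..<n}. (fst p i, ?y p i))) (gauss n) ?f"
    using assms by (simp only: distr_gauss_corr_pair)
  also have "\<dots> = distr ?P (gauss n) (?f \<circ> (\<lambda>p. \<lambda>i\<in>{..<n}. (fst p i, ?y p i)))"
    by (rule distr_distr[OF f measurable_corr_pairs(1)])
  also have "\<dots> = distr ?P (gauss n) fst"
    by (intro distr_cong refl) (auto simp: space_pair_measure space_gauss extensional_def fun_eq_iff)
  finally show ?thesis by (simp only: distr_gauss_pair_fst)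
qed

text \<open>\<open>f_opt3\<close> reads three coordinates, so the n independent correlated pairs may
  be restricted to three. Zero vectors cause no mismatch: both normalisations return 0
  there.\<close>

lemma Stab_f_opt3:
  assumes "-1 \<le> \<rho>" "\<rho> \<le> 1" "n \<ge> 3"
  shows "Stab n \<rho> f_opt3 = Fstar 3 \<rho>"
proof -
  let ?P = "gauss n \<Otimes>\<^sub>M gauss n"
  let ?y = "\<lambda>p. corr_partner n \<rho> (fst p) (snd p)"
  let ?r = "\<lambda>p. \<lambda>i\<in>{..<n}. (fst p i, ?y p i)"
  interpret product_prob_space "\<lambda>_. corr_normal \<rho>" "{..<n}"
    by (rule product_prob_spaceI) (rule prob_space_corr_normal)
  have "distr (PiM {..<n} (\<lambda>_. corr_normal \<rho>)) (PiM {..<3} (\<lambda>_. corr_normal \<rho>)) (\<lambda>q. restrict q {..<3})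
      = PiM {..<3} (\<lambda>_. corr_normal \<rho>)"
    using assms by (intro distr_PiM_restrict_finite) auto
  then have "Fstar 3 \<rho> = (\<integral>q. unit_dot3 q \<partial>distr (PiM {..<n} (\<lambda>_. corr_normal \<rho>)) (PiM {..<3} (\<lambda>_. corr_normal \<rho>)) (\<lambda>q. restrict q {..<3}))"
    using assms by (simp add: Fstar3_eq_corr)
  also have "\<dots> = (\<integral>q. unit_dot3 (restrict q {..<3}) \<partial>PiM {..<n} (\<lambda>_. corr_normal \<rho>))"
    using assms by (intro integral_distr measurable_restrict_subset) auto
  also have "\<dots> = (\<integral>q. unit_dot3 (restrict q {..<3}) \<partial>distr ?P (PiM {..<n} (\<lambda>_. borel \<Otimes>\<^sub>M borel)) ?r)"
    using assms by (simp add: distr_gauss_corr_pair)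
  also have "\<dots> = (\<integral>p. unit_dot3 (restrict (?r p) {..<3}) \<partial>?P)"
  proof (rule integral_distr)
    have [measurable]: "(\<lambda>q. restrict q {..<3}) \<in> PiM {..<n} (\<lambda>_. borel \<Otimes>\<^sub>M borel) \<rightarrow>\<^sub>M PiM {..<3} (\<lambda>_. borel \<Otimes>\<^sub>M borel :: (real \<times> real) measure)"
      using assms by (intro measurable_restrict_subset) auto
    show "(\<lambda>q. unit_dot3 (restrict q {..<3})) \<in> borel_measurable (PiM {..<n} (\<lambda>_. borel \<Otimes>\<^sub>M borel))"
      by measurable
  qed (rule measurable_corr_pairs)
  also have "\<dots> = Stab n \<rho> f_opt3"
    unfolding Stab_def
  proof (intro Bochner_Integration.integral_cong refl)
    fix p
    have "norm (vector [x 0, x 1, x 2] :: real^3) = sqrt ((x 0)\<^sup>2 + (x 1)\<^sup>2 + (x 2)\<^sup>2)" for x :: "nat \<Rightarrow> real"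
      by (simp add: norm_eq_sqrt_inner inner_vec_def sum_3 power2_eq_square)
    then have "inner (f_opt3 x) (f_opt3 y) = (\<Sum>i<3. (x i / sqrt (\<Sum>i<3. (x i)\<^sup>2)) * (y i / sqrt (\<Sum>i<3. (y i)\<^sup>2)))" for x y
      by (simp add: f_opt3_def Let_def inner_vec_def sum_3 lessThan_Suc numeral_3_eq_3 numeral_2_eq_2 add.commute add.left_commute)
    then show "unit_dot3 (restrict (?r p) {..<3}) = inner (f_opt3 (fst p)) (f_opt3 (?y p))"
      using assms by (simp add: unit_dot3_def)
  qed
  finally show ?thesis ..
qed

section \<open>Gaussian moments and concentration of the norm\<close>

lemma integrable_std_normal_power: "integrable std_normal (\<lambda>x. x ^ k)"
  by (subst integrable_density) (simp_all add: integrable_std_normal_moment)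

lemma integral_std_normal_power2: "(\<integral>x. x\<^sup>2 \<partial>std_normal) = 1"
  and integral_std_normal_power4: "(\<integral>x. x ^ 4 \<partial>std_normal) = 3"
  and integral_std_normal_id: "(\<integral>x. x \<partial>std_normal) = 0"
  using integral_std_normal_moment_even[of 1] integral_std_normal_moment_even[of 2] integral_std_normal_moment_odd[of 0]
  by (simp_all add: integral_density fact_numeral)

lemma
  fixes h :: "real \<Rightarrow> real"
  assumes i: "i \<in> I" and h: "integrable std_normal h"
  shows integrable_gauss_on_component: "integrable (gauss_on I) (\<lambda>x. h (x i))"
    and integral_gauss_on_component: "(\<integral>x. h (x i) \<partial>gauss_on I) = (\<integral>t. h t \<partial>std_normal)"
proof -
  have d: "distr (gauss_on I) std_normal (\<lambda>x. x i) = std_normal"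
    unfolding gauss_on_def using i by (intro distr_PiM_component prob_space_std_normal)
  have m: "(\<lambda>x. x i) \<in> gauss_on I \<rightarrow>\<^sub>M std_normal"
    unfolding gauss_on_def using i by (rule measurable_component_singleton)
  have h': "h \<in> borel_measurable std_normal" using h by (rule borel_measurable_integrable)
  show "integrable (gauss_on I) (\<lambda>x. h (x i))"
    using h by (subst (asm) d[symmetric]) (rule integrable_distr[OF m])
  show "(\<integral>x. h (x i) \<partial>gauss_on I) = (\<integral>t. h t \<partial>std_normal)"
    using integral_distr[OF m h'] by (simp add: d)
qed

lemma
  fixes h :: "real \<Rightarrow> real"
  assumes I: "finite I" "i \<in> I" "j \<in> I" "i \<noteq> j" and h: "integrable std_normal h"
  shows integrable_gauss_on_two: "integrable (gauss_on I) (\<lambda>x. h (x i) * h (x j))"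
    and integral_gauss_on_two: "(\<integral>x. h (x i) * h (x j) \<partial>gauss_on I) = (\<integral>t. h t \<partial>std_normal)\<^sup>2"
proof -
  interpret product_prob_space "\<lambda>_. std_normal" I
    by (rule product_prob_spaceI) (rule prob_space_std_normal)
  \<comment> \<open>Factors 1 at all other coordinates turn a product over \<open>I\<close>, to
    which independence applies, into the two factors wanted.\<close>
  define g where "g k t = (if k \<in> {i, j} then h t else 1)" for k t
  have g: "integrable std_normal (g k)" for k
    using h M.integrable_const[of "1::real"] by (cases "k \<in> {i, j}") (simp_all add: g_def[abs_def])
  have "(\<Prod>k\<in>I. g k (x k)) = (\<Prod>k\<in>{i, j}. g k (x k))" for x
    using I by (intro prod.mono_neutral_right) (auto simp: g_def)
  then have x: "(\<Prod>k\<in>I. g k (x k)) = h (x i) * h (x j)" for x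
    using I by (simp add: g_def)
  have "(\<Prod>k\<in>I. \<integral>t. g k t \<partial>std_normal) = (\<Prod>k\<in>{i, j}. \<integral>t. g k t \<partial>std_normal)"
    using I M.prob_space by (intro prod.mono_neutral_right) (auto simp: g_def[abs_def])
  then have e: "(\<Prod>k\<in>I. \<integral>t. g k t \<partial>std_normal) = (\<integral>t. h t \<partial>std_normal)\<^sup>2"
    using I by (simp add: g_def[abs_def] power2_eq_square)
  show "integrable (gauss_on I) (\<lambda>x. h (x i) * h (x j))"
    using product_integrable_prod[of I g] I(1) g by (simp add: x gauss_on_def)
  show "(\<integral>x. h (x i) * h (x j) \<partial>gauss_on I) = (\<integral>t. h t \<partial>std_normal)\<^sup>2"
    using product_integral_prod[of I g] I(1) g by (simp add: x e gauss_on_def)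
qed

text \<open>The variance of a normalised chi-square variable: the terms t^2 - 1 are centred and
  independent with second moment 3 - 2 + 1 = 2, so only the n diagonal terms survive, giving 2 n /
  n^2.\<close>

lemma
  assumes n: "n \<ge> 1"
  shows integrable_gauss_norm_sq_dev: "integrable (gauss n) (\<lambda>x. ((\<Sum>k<n. (x k)\<^sup>2) / n - 1)\<^sup>2)"
    and integral_gauss_norm_sq_dev: "(\<integral>x. ((\<Sum>k<n. (x k)\<^sup>2) / n - 1)\<^sup>2 \<partial>gauss n) = 2 / n"
proof -
  interpret prob_space std_normal by (rule prob_space_std_normal)
  define h where "h t = t\<^sup>2 - 1" for t :: real
  have int_h: "integrable std_normal h"
    unfolding h_def[abs_def] by (intro Bochner_Integration.integrable_diff integrable_std_normal_power integrable_const)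
  have h0: "(\<integral>t. h t \<partial>std_normal) = 0"
    unfolding h_def[abs_def] using prob_space
    by (subst Bochner_Integration.integral_diff)
       (auto simp: integrable_std_normal_power integral_std_normal_power2)
  have h_sq: "(\<lambda>t. h t * h t) = (\<lambda>t. t ^ 4 - 2 * t\<^sup>2 + 1)"
    by (auto simp: h_def fun_eq_iff algebra_simps power2_eq_square power4_eq_xxxx)
  have int_h2: "integrable std_normal (\<lambda>t. h t * h t)"
    unfolding h_sq by (intro Bochner_Integration.integrable_add Bochner_Integration.integrable_diff integrable_mult_right integrable_std_normal_power integrable_const)
  have h2: "(\<integral>t. h t * h t \<partial>std_normal) = 2"
  proof -
    have "(\<integral>t. t ^ 4 - 2 * t\<^sup>2 + 1 \<partial>std_normal) = (\<integral>t. t ^ 4 - 2 * t\<^sup>2 \<partial>std_normal) + (\<integral>t. 1 \<partial>std_normal)"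
      by (intro Bochner_Integration.integral_add Bochner_Integration.integrable_diff integrable_mult_right integrable_std_normal_power integrable_const)
    also have "(\<integral>t. t ^ 4 - 2 * t\<^sup>2 \<partial>std_normal) = (\<integral>t. t ^ 4 \<partial>std_normal) - (\<integral>t. 2 * t\<^sup>2 \<partial>std_normal)"
      by (intro Bochner_Integration.integral_diff integrable_mult_right integrable_std_normal_power)
    also have "(\<integral>t. 1 \<partial>std_normal) = (1 :: real)" using prob_space by simp
    finally show ?thesis unfolding h_sq by (simp add: integral_std_normal_power2 integral_std_normal_power4)
  qed
  have int: "integrable (gauss n) (\<lambda>x. h (x i) * h (x j))" if "i < n" "j < n" for i j
  proof (cases "i = j")
    case True
    then show ?thesis
      using integrable_gauss_on_component[of i "{..<n}" "\<lambda>t. h t * h t"] int_h2 that by (simp add: gauss_def)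
  qed (use that int_h in \<open>auto simp: gauss_def intro!: integrable_gauss_on_two\<close>)
  have E: "(\<integral>x. h (x i) * h (x j) \<partial>gauss n) = (if i = j then 2 else 0)" if "i < n" "j < n" for i j
  proof (cases "i = j")
    case True
    then show ?thesis
      using integral_gauss_on_component[of i "{..<n}" "\<lambda>t. h t * h t"] int_h2 that h2 by (simp add: gauss_def)
  qed (use that int_h h0 in \<open>auto simp: gauss_def integral_gauss_on_two\<close>)
  have eq: "((\<Sum>k<n. (x k)\<^sup>2) / n - 1)\<^sup>2 = (\<Sum>i<n. \<Sum>j<n. h (x i) * h (x j)) / (real n)\<^sup>2" for x
  proof -
    have "(\<Sum>k<n. (x k)\<^sup>2) / n - 1 = (\<Sum>k<n. h (x k)) / n"
      using n by (simp add: h_def sum_subtractf field_simps)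
    then show ?thesis by (simp add: power_divide power2_eq_square sum_product)
  qed
  show "integrable (gauss n) (\<lambda>x. ((\<Sum>k<n. (x k)\<^sup>2) / n - 1)\<^sup>2)"
    unfolding eq by (intro integrable_divide Bochner_Integration.integrable_sum int) auto
  have "(\<integral>x. (\<Sum>i<n. \<Sum>j<n. h (x i) * h (x j)) \<partial>gauss n) = (\<Sum>i<n. \<integral>x. (\<Sum>j<n. h (x i) * h (x j)) \<partial>gauss n)"
    by (intro Bochner_Integration.integral_sum Bochner_Integration.integrable_sum int) auto
  also have "\<dots> = (\<Sum>i<n. \<Sum>j<n. \<integral>x. h (x i) * h (x j) \<partial>gauss n)"
    by (intro sum.cong refl Bochner_Integration.integral_sum int) auto
  also have "\<dots> = 2 * n" by (simp add: E)
  finally show "(\<integral>x. ((\<Sum>k<n. (x k)\<^sup>2) / n - 1)\<^sup>2 \<partial>gauss n) = 2 / n"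
    unfolding eq using n by (simp add: power2_eq_square)
qed

lemma
  shows integrable_gauss_norm_sq: "integrable (gauss n) (\<lambda>x. \<Sum>k<n. (x k)\<^sup>2)"
    and integral_gauss_norm_sq: "(\<integral>x. (\<Sum>k<n. (x k)\<^sup>2) \<partial>gauss n) = n"
proof -
  have int: "integrable (gauss n) (\<lambda>x. (x k)\<^sup>2)" "(\<integral>x. (x k)\<^sup>2 \<partial>gauss n) = 1" if "k \<in> {..<n}" for k
    using integrable_gauss_on_component[OF that integrable_std_normal_power[of 2]]
      integral_gauss_on_component[OF that integrable_std_normal_power[of 2]]
    by (simp_all add: gauss_def integral_std_normal_power2)
  show "integrable (gauss n) (\<lambda>x. \<Sum>k<n. (x k)\<^sup>2)"
    by (intro Bochner_Integration.integrable_sum int)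
  show "(\<integral>x. (\<Sum>k<n. (x k)\<^sup>2) \<partial>gauss n) = n"
    by (subst Bochner_Integration.integral_sum) (simp_all add: int)
qed

text \<open>Each summand is \<rho> times the square of a normal plus a multiple of a product of two
  independent normals, with means \<rho> and 0.\<close>

lemma
  shows integrable_corr_inner: "integrable (gauss n \<Otimes>\<^sub>M gauss n) (\<lambda>p. \<Sum>k<n. fst p k * corr_partner n \<rho> (fst p) (snd p) k)"
    and integral_corr_inner: "(\<integral>p. (\<Sum>k<n. fst p k * corr_partner n \<rho> (fst p) (snd p) k) \<partial>(gauss n \<Otimes>\<^sub>M gauss n)) = n * \<rho>"
proof -
  let ?P = "gauss n \<Otimes>\<^sub>M gauss n"
  let ?G = "gauss_on ({..<n} \<times> {..<2::nat})"
  let ?m = "\<lambda>p. \<lambda>k\<in>{..<n} \<times> {..<2::nat}. if snd k = 0 then fst p (fst k) else snd p (fst k)"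
  let ?s = "sqrt (1 - \<rho>\<^sup>2)"
  have m: "?m \<in> ?P \<rightarrow>\<^sub>M ?G" unfolding gauss_def by (rule measurable_merge_columns)
  have d: "distr ?P ?G ?m = ?G" unfolding gauss_def by (rule gauss_on_eq_distr_pair) simp
  have id: "integrable std_normal (\<lambda>x. x)" using integrable_std_normal_power[of 1] by simp
  have k: "integrable ?P (\<lambda>p. fst p k * corr_partner n \<rho> (fst p) (snd p) k)
      \<and> (\<integral>p. fst p k * corr_partner n \<rho> (fst p) (snd p) k \<partial>?P) = \<rho>" if k: "k \<in> {..<n}" for k
  proof -
    let ?f = "\<lambda>Z. \<rho> * (Z (k, 0))\<^sup>2 + ?s * (Z (k, 0) * Z (k, 1))"
    have i1: "integrable ?G (\<lambda>Z. (Z (k, 0))\<^sup>2)" "(\<integral>Z. (Z (k, 0))\<^sup>2 \<partial>?G) = 1"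
      using k integrable_gauss_on_component[OF _ integrable_std_normal_power[of 2], of "(k, 0)" "{..<n} \<times> {..<2::nat}"]
        integral_gauss_on_component[OF _ integrable_std_normal_power[of 2], of "(k, 0)" "{..<n} \<times> {..<2::nat}"]
      by (simp_all add: integral_std_normal_power2)
    have i2: "integrable ?G (\<lambda>Z. Z (k, 0) * Z (k, 1))" "(\<integral>Z. Z (k, 0) * Z (k, 1) \<partial>?G) = 0"
      using k integrable_gauss_on_two[OF _ _ _ _ id, of "{..<n} \<times> {..<2::nat}" "(k, 0)" "(k, 1)"]
        integral_gauss_on_two[OF _ _ _ _ id, of "{..<n} \<times> {..<2::nat}" "(k, 0)" "(k, 1)"]
      by (simp_all add: integral_std_normal_id)
    have f: "integrable ?G ?f" "(\<integral>Z. ?f Z \<partial>?G) = \<rho>"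
      using i1 i2 by simp_all
    have eq: "?f (?m p) = fst p k * corr_partner n \<rho> (fst p) (snd p) k" for p
      using k by (simp add: corr_partner_def algebra_simps power2_eq_square)
    have "integrable ?P (\<lambda>p. ?f (?m p))"
      using f(1) by (subst (asm) d[symmetric]) (rule integrable_distr[OF m])
    moreover have "(\<integral>p. ?f (?m p) \<partial>?P) = \<rho>"
      using integral_distr[OF m, of ?f] f by (simp only: d borel_measurable_integrable)
    ultimately show ?thesis by (simp only: eq)
  qed
  show "integrable ?P (\<lambda>p. \<Sum>k<n. fst p k * corr_partner n \<rho> (fst p) (snd p) k)"
    using k by (intro Bochner_Integration.integrable_sum) blast
  show "(\<integral>p. (\<Sum>k<n. fst p k * corr_partner n \<rho> (fst p) (snd p) k) \<partial>?P) = n * \<rho>"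
    using k by (subst Bochner_Integration.integral_sum) auto
qed

section \<open>Directions and a finite partition of them\<close>

definition unit_dir :: "nat \<Rightarrow> (nat \<Rightarrow> real) \<Rightarrow> nat \<Rightarrow> real" where
  "unit_dir n x k = (if (\<Sum>k<n. (x k)\<^sup>2) = 0 then (if k = 0 then 1 else 0) else x k / sqrt (\<Sum>k<n. (x k)\<^sup>2))"

text \<open>Holds at x = 0 too, because \<open>unit_dir\<close> defaults to a basis vector there; n
  \<ge> 1 makes its coordinate present. So every vertex of the graph will carry a unit
  vector.\<close>

lemma sum_unit_dir_sq:
  assumes "n \<ge> 1"
  shows "(\<Sum>k<n. (unit_dir n x k)\<^sup>2) = 1"
proof (cases "(\<Sum>k<n. (x k)\<^sup>2) = 0")
  case True
  then show ?thesis using assms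
    by (simp add: unit_dir_def if_distrib[of "\<lambda>x. x\<^sup>2"] cong: if_cong)
next
  case False
  then show ?thesis
    by (simp add: unit_dir_def power_divide sum_nonneg flip: sum_divide_distrib)
qed

lemma sum_unit_dir_mult:
  "(\<Sum>k<n. unit_dir n x k * x k) = sqrt (\<Sum>k<n. (x k)\<^sup>2)"
proof (cases "(\<Sum>k<n. (x k)\<^sup>2) = 0")
  case True
  then have "\<forall>k\<in>{..<n}. (x k)\<^sup>2 = 0" by (subst (asm) sum_nonneg_eq_0_iff) auto
  then show ?thesis using True by (simp add: sum.neutral)
next
  case False
  then have "(\<Sum>k<n. unit_dir n x k * x k) = (\<Sum>k<n. (x k)\<^sup>2) / sqrt (\<Sum>k<n. (x k)\<^sup>2)"
    by (simp add: unit_dir_def power2_eq_square sum_divide_distrib)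
  also have "\<dots> = sqrt (\<Sum>k<n. (x k)\<^sup>2)" by (simp add: real_div_sqrt sum_nonneg)
  finally show ?thesis .
qed

text \<open>x / sqrt n points along the direction of x and has length t = |x| / sqrt n, so the left
  side is (1 - t)^2. The factor (1 + t)^2 \<ge> 1 replaces |x| by |x|^2, whose variance is
  known.\<close>

lemma unit_dir_close:
  assumes n: "n \<ge> 1"
  shows "(\<Sum>k<n. (unit_dir n x k - x k / sqrt n)\<^sup>2) \<le> ((\<Sum>k<n. (x k)\<^sup>2) / n - 1)\<^sup>2"
proof -
  define t where "t = sqrt ((\<Sum>k<n. (x k)\<^sup>2) / n)"
  have t: "t \<ge> 0" "t\<^sup>2 = (\<Sum>k<n. (x k)\<^sup>2) / n" by (simp_all add: t_def sum_nonneg)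
  have "(\<Sum>k<n. (unit_dir n x k - x k / sqrt n)\<^sup>2)
      = (\<Sum>k<n. (unit_dir n x k)\<^sup>2) - 2 * (\<Sum>k<n. unit_dir n x k * x k) / sqrt n + (\<Sum>k<n. (x k)\<^sup>2) / n"
    by (simp add: power2_diff sum.distrib sum_subtractf power_divide sum_distrib_left sum_divide_distrib mult.assoc)
  also have "\<dots> = 1 - 2 * t + t\<^sup>2"
    unfolding sum_unit_dir_sq[OF n] sum_unit_dir_mult t(2) by (simp add: t_def real_sqrt_divide)
  also have "\<dots> = (1 - t)\<^sup>2 * 1" by (simp add: power2_diff)
  also have "\<dots> \<le> (1 - t)\<^sup>2 * (1 + t)\<^sup>2" using t by (intro mult_left_mono) (auto simp: one_le_power)
  also have "\<dots> = (t\<^sup>2 - 1)\<^sup>2" by (simp add: power2_eq_square algebra_simps)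
  finally show ?thesis by (simp add: t)
qed

lemma abs_unit_dir_le_1:
  assumes "k < n"
  shows "\<bar>unit_dir n x k\<bar> \<le> 1"
proof -
  have "(unit_dir n x k)\<^sup>2 \<le> (\<Sum>k<n. (unit_dir n x k)\<^sup>2)"
    using assms by (intro member_le_sum) auto
  then show ?thesis using assms by (simp add: sum_unit_dir_sq abs_square_le_1)
qed

lemma measurable_unit_dir:
  assumes "k < n"
  shows "(\<lambda>x. unit_dir n x k) \<in> borel_measurable (gauss n)"
proof -
  have c: "(\<lambda>x. x j) \<in> borel_measurable (gauss n)" if "j < n" for j
    using that unfolding gauss_def by (intro measurable_gauss_component) simp
  define S where "S x = (\<Sum>k<n. (x k)\<^sup>2)" for x :: "nat \<Rightarrow> real"
  have S: "S \<in> borel_measurable (gauss n)"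
    unfolding S_def by (intro borel_measurable_sum borel_measurable_power c) simp
  have "{x \<in> space (gauss n). S x = 0} \<in> sets (gauss n)"
    using measurable_sets[OF S, of "{0}"] by (simp add: vimage_def Int_def conj_commute)
  moreover have "(\<lambda>x. x k / sqrt (S x)) \<in> borel_measurable (gauss n)"
    by (intro borel_measurable_divide c assms measurable_compose[OF S] borel_measurable_sqrt)
  ultimately have "(\<lambda>x. if S x = 0 then (if k = 0 then 1 else 0) else x k / sqrt (S x)) \<in> borel_measurable (gauss n)"
    by (intro measurable_If borel_measurable_const)
  then show ?thesis unfolding unit_dir_def S_def .
qed

text \<open>The coordinates of the direction are rounded down to a grid of mesh 1/n, each cell
  becoming a vertex. Directions in one cell differ by at most 1/n per coordinate, hence by n (1/n)^2
  = 1/n in squared distance.\<close>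

lemma sphere_discretization:
  assumes n: "n \<ge> 1"
  obtains N X and c :: "nat \<Rightarrow> nat \<Rightarrow> real" where "n \<le> N" "X \<in> gauss n \<rightarrow>\<^sub>M count_space {..<N}"
    "\<And>i. (\<Sum>k<n. (c i k)\<^sup>2) = 1"
    "\<And>x. x \<in> space (gauss n) \<Longrightarrow> (\<Sum>k<n. (c (X x) k - unit_dir n x k)\<^sup>2) \<le> 1 / n"
proof -
  define \<Phi> where "\<Phi> = PiE {..<n} (\<lambda>_. {- int n..int n})"
  define \<phi> where "\<phi> x = (\<lambda>k\<in>{..<n}. \<lfloor>n * unit_dir n x k\<rfloor>)" for x
  have "finite \<Phi>" by (auto simp: \<Phi>_def intro!: finite_PiE)
  then obtain m e where e: "e ` \<Phi> = {i::nat. i < m}" "inj_on e \<Phi>"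
    using finite_imp_inj_to_nat_seg[of \<Phi>] by metis
  have \<phi>: "\<phi> x \<in> \<Phi>" for x
  proof -
    have "\<lfloor>n * unit_dir n x k\<rfloor> \<in> {- int n..int n}" if "k < n" for k
    proof -
      have "- real n \<le> n * unit_dir n x k" "n * unit_dir n x k \<le> n"
        using abs_unit_dir_le_1[OF that, of x] mult_left_mono[of "-1" "unit_dir n x k" "real n"]
          mult_left_mono[of "unit_dir n x k" 1 "real n"] by (simp_all add: abs_le_iff)
      then show ?thesis by (auto simp: le_floor_iff floor_le_iff)
    qed
    then show ?thesis by (auto simp: \<phi>_def \<Phi>_def)
  qed
  define X where "X x = e (\<phi> x)" for x
  \<comment> \<open>A cell is represented by the direction of some point in it. For an index that no
    point reaches the choice is arbitrary, yet \<open>unit_dir\<close> is still a unit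
    vector.\<close>
  define c where "c i = unit_dir n (SOME x. x \<in> space (gauss n) \<and> X x = i)" for i
  \<comment> \<open>The n additional indices are isolated vertices ensuring n \<le> N, so that SDP
    vectors, which have N coordinates, have room for vectors of n-dimensional space.\<close>
  show thesis
  proof (rule that[of "m + n" X c])
    have Xm: "X x < m" for x using e(1) \<phi>[of x] by (auto simp: X_def)
    have "X -` {a} \<inter> space (gauss n) \<in> sets (gauss n)" for a
    proof (cases "a \<in> e ` \<Phi>")
      case True
      then obtain g where g: "g \<in> \<Phi>" "a = e g" by auto
      have "X x = a \<longleftrightarrow> (\<forall>k\<in>{..<n}. \<lfloor>n * unit_dir n x k\<rfloor> = g k)" for x
      proof -
        have "X x = a \<longleftrightarrow> \<phi> x = g" using inj_on_eq_iff[OF e(2) \<phi> g(1)] by (simp add: X_def g)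
        also have "\<dots> \<longleftrightarrow> (\<forall>k\<in>{..<n}. \<phi> x k = g k)"
          using \<phi>[of x] g(1) by (auto simp: \<Phi>_def intro: PiE_ext)
        finally show ?thesis by (simp add: \<phi>_def)
      qed
      then have "X -` {a} \<inter> space (gauss n) = {x \<in> space (gauss n). \<forall>k\<in>{..<n}. \<lfloor>n * unit_dir n x k\<rfloor> = g k}"
        by auto
      also have "\<dots> \<in> sets (gauss n)"
      proof (rule sets.sets_Collect_finite_All)
        fix k assume "k \<in> {..<n}"
        then have "(\<lambda>x. n * unit_dir n x k) \<in> borel_measurable (gauss n)"
          by (intro borel_measurable_times measurable_unit_dir) simp_all
        then have "(\<lambda>x. \<lfloor>n * unit_dir n x k\<rfloor>) -` {g k} \<inter> space (gauss n) \<in> sets (gauss n)"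
          by (rule measurable_sets[OF measurable_compose[OF _ measurable_real_floor]]) simp
        also have "(\<lambda>x. \<lfloor>n * unit_dir n x k\<rfloor>) -` {g k} \<inter> space (gauss n) = {x \<in> space (gauss n). \<lfloor>n * unit_dir n x k\<rfloor> = g k}"
          by blast
        finally show "{x \<in> space (gauss n). \<lfloor>n * unit_dir n x k\<rfloor> = g k} \<in> sets (gauss n)" .
      qed simp
      finally show ?thesis .
    next
      case False
      then have "X -` {a} \<inter> space (gauss n) = {}" using \<phi> by (auto simp: X_def)
      then show ?thesis by simp
    qed
    then show "X \<in> gauss n \<rightarrow>\<^sub>M count_space {..<m + n}"
      unfolding measurable_count_space_eq2[OF finite_lessThan] using Xm by (blast intro: trans_less_add1 lessThan_iff[THEN iffD2])
    show "(\<Sum>k<n. (c i k)\<^sup>2) = 1" for i unfolding c_def by (rule sum_unit_dir_sq[OF n])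
    fix x assume x: "x \<in> space (gauss n)"
    define x' where "x' = (SOME x'. x' \<in> space (gauss n) \<and> X x' = X x)"
    have "X x' = X x" unfolding x'_def by (rule someI2[of _ x]) (use x in auto)
    then have "\<phi> x' = \<phi> x" using inj_onD[OF e(2)] \<phi> by (auto simp: X_def)
    have "(\<Sum>k<n. (c (X x) k - unit_dir n x k)\<^sup>2) \<le> (\<Sum>k<n. (1 / n)\<^sup>2)"
    proof (rule sum_mono)
      fix k assume k: "k \<in> {..<n}"
      have "\<lfloor>n * unit_dir n x' k\<rfloor> = \<lfloor>n * unit_dir n x k\<rfloor>"
        using fun_cong[OF \<open>\<phi> x' = \<phi> x\<close>, of k] k by (simp add: \<phi>_def)
      then have "\<bar>n * unit_dir n x' k - n * unit_dir n x k\<bar> \<le> 1" by linarith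
      then have "n * \<bar>unit_dir n x' k - unit_dir n x k\<bar> \<le> 1"
        by (simp add: right_diff_distrib[symmetric] abs_mult)
      then have "\<bar>c (X x) k - unit_dir n x k\<bar> \<le> 1 / n"
        using n by (simp add: c_def x'_def field_simps)
      then show "(c (X x) k - unit_dir n x k)\<^sup>2 \<le> (1 / n)\<^sup>2"
        by (rule power2_le_iff_abs_le[THEN iffD2, rotated]) simp
    qed
    also have "\<dots> = 1 / n" using n by (simp add: power2_eq_square)
    finally show "(\<Sum>k<n. (c (X x) k - unit_dir n x k)\<^sup>2) \<le> 1 / n" .
  qed simp
qed

section \<open>Averages over the discretised Gaussian pair\<close>

lemma sum_square_split:
  fixes g :: "nat \<Rightarrow> nat \<Rightarrow> real"
  shows "(\<Sum>i<N. \<Sum>j<N. g i j) = (\<Sum>j<N. g j j) + (\<Sum>j<N. \<Sum>i<j. g i j + g j i)"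
proof (induction N)
  case (Suc N)
  have "(\<Sum>i<Suc N. \<Sum>j<Suc N. g i j) = (\<Sum>i<N. \<Sum>j<N. g i j) + (\<Sum>i<N. g i N) + (\<Sum>j<N. g N j) + g N N"
    by (simp add: sum.distrib)
  then show ?case unfolding Suc.IH by (simp only: sum.lessThan_Suc sum.distrib ac_simps)
qed simp

text \<open>Expectations over the pair of cells become finite sums over ordered pairs of vertices,
  the bridge to \<open>edge_obj\<close>.\<close>

lemma (in prob_space)
  fixes h :: "nat \<Rightarrow> nat \<Rightarrow> real"
  assumes X: "X \<in> M \<rightarrow>\<^sub>M count_space {..<N}" and Y: "Y \<in> M \<rightarrow>\<^sub>M count_space {..<N}"
  shows integrable_finite_pair: "integrable M (\<lambda>p. h (X p) (Y p))"
    and expectation_finite_pair: "expectation (\<lambda>p. h (X p) (Y p)) = (\<Sum>i<N. \<Sum>j<N. h i j * prob {p \<in> space M. X p = i \<and> Y p = j})"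
proof -
  let ?A = "\<lambda>i j. {p \<in> space M. X p = i \<and> Y p = j}"
  have A: "?A i j \<in> events" if "i < N" "j < N" for i j
  proof -
    have "?A i j = (X -` {i} \<inter> space M) \<inter> (Y -` {j} \<inter> space M)" by auto
    then show ?thesis using that measurable_sets[OF X, of "{i}"] measurable_sets[OF Y, of "{j}"] by auto
  qed
  have int: "integrable M (\<lambda>p. h i j * indicator (?A i j) p)" if "i < N" "j < N" for i j
    using A[OF that] by (intro integrable_mult_right integrable_real_indicator) (auto simp: less_top[symmetric])
  have eq: "h (X p) (Y p) = (\<Sum>i<N. \<Sum>j<N. h i j * indicator (?A i j) p)" if p: "p \<in> space M" for p
  proof -
    have XY: "X p < N" "Y p < N" using measurable_space[OF X p] measurable_space[OF Y p] by auto
    have "(\<Sum>i<N. \<Sum>j<N. h i j * indicator (?A i j) p)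
        = (\<Sum>i<N. \<Sum>j<N. if i = X p then (if j = Y p then h i j else 0) else 0)"
      using p by (intro sum.cong refl) (auto simp: indicator_def)
    also have "\<dots> = (\<Sum>i<N. if i = X p then (\<Sum>j<N. if j = Y p then h i j else 0) else 0)"
      by (intro sum.cong refl) auto
    also have "\<dots> = h (X p) (Y p)" using XY by simp
    finally show ?thesis ..
  qed
  have "integrable M (\<lambda>p. \<Sum>i<N. \<Sum>j<N. h i j * indicator (?A i j) p)"
    by (intro Bochner_Integration.integrable_sum int) auto
  then show "integrable M (\<lambda>p. h (X p) (Y p))"
    by (simp cong: Bochner_Integration.integrable_cong add: eq)
  have "expectation (\<lambda>p. h (X p) (Y p)) = expectation (\<lambda>p. \<Sum>i<N. \<Sum>j<N. h i j * indicator (?A i j) p)"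
    by (intro Bochner_Integration.integral_cong refl eq)
  also have "\<dots> = (\<Sum>i<N. expectation (\<lambda>p. \<Sum>j<N. h i j * indicator (?A i j) p))"
    by (intro Bochner_Integration.integral_sum Bochner_Integration.integrable_sum int) auto
  also have "\<dots> = (\<Sum>i<N. \<Sum>j<N. expectation (\<lambda>p. h i j * indicator (?A i j) p))"
    by (intro sum.cong refl Bochner_Integration.integral_sum int) auto
  also have "\<dots> = (\<Sum>i<N. \<Sum>j<N. h i j * prob (?A i j))"
    using A by (intro sum.cong refl) simp
  finally show "expectation (\<lambda>p. h (X p) (Y p)) = (\<Sum>i<N. \<Sum>j<N. h i j * prob (?A i j))" .
qed

text \<open>Combines ab - a'b' = (a - a') b + (b - b') a' with uv \<le> \<kappa> u^2 / 2 + v^2 / (2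
  \<kappa>). The parameter balances small squared distances against squared norms of order 1; for
  distances squared of order 1/n the choice will be \<kappa> = sqrt n.\<close>

lemma inner_perturb_le:
  fixes a b a' b' :: "nat \<Rightarrow> real"
  assumes \<kappa>: "\<kappa> > 0"
  shows "(\<Sum>k\<in>K. a k * b k) \<le> (\<Sum>k\<in>K. a' k * b' k)
    + \<kappa> / 2 * ((\<Sum>k\<in>K. (a k - a' k)\<^sup>2) + (\<Sum>k\<in>K. (b k - b' k)\<^sup>2))
    + 1 / (2 * \<kappa>) * ((\<Sum>k\<in>K. (b k)\<^sup>2) + (\<Sum>k\<in>K. (a' k)\<^sup>2))"
proof -
  have amgm: "u * v \<le> \<kappa> / 2 * u\<^sup>2 + 1 / (2 * \<kappa>) * v\<^sup>2" for u v
  proof -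
    have "0 \<le> (\<kappa> * u - v)\<^sup>2 / (2 * \<kappa>)" using \<kappa> by simp
    also have "\<dots> = \<kappa> / 2 * u\<^sup>2 + 1 / (2 * \<kappa>) * v\<^sup>2 - u * v"
      using \<kappa> by (simp add: power2_diff field_simps power2_eq_square)
    finally show ?thesis by simp
  qed
  have "(\<Sum>k\<in>K. a k * b k) \<le> (\<Sum>k\<in>K. a' k * b' k + \<kappa> / 2 * ((a k - a' k)\<^sup>2 + (b k - b' k)\<^sup>2) + 1 / (2 * \<kappa>) * ((b k)\<^sup>2 + (a' k)\<^sup>2))"
  proof (rule sum_mono)
    fix k
    have "a k * b k = a' k * b' k + (a k - a' k) * b k + (b k - b' k) * a' k" by (simp add: algebra_simps)
    also have "\<dots> \<le> a' k * b' k + (\<kappa> / 2 * (a k - a' k)\<^sup>2 + 1 / (2 * \<kappa>) * (b k)\<^sup>2) + (\<kappa> / 2 * (b k - b' k)\<^sup>2 + 1 / (2 * \<kappa>) * (a' k)\<^sup>2)"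
      by (intro add_mono order_refl amgm)
    finally show "a k * b k \<le> a' k * b' k + \<kappa> / 2 * ((a k - a' k)\<^sup>2 + (b k - b' k)\<^sup>2) + 1 / (2 * \<kappa>) * ((b k)\<^sup>2 + (a' k)\<^sup>2)"
      by (simp add: algebra_simps)
  qed
  then show ?thesis by (simp only: sum.distrib flip: sum_distrib_left)
qed

lemma sum_sq_diff_triangle:
  fixes a b d :: "nat \<Rightarrow> real"
  shows "(\<Sum>k\<in>K. (a k - b k)\<^sup>2) \<le> 2 * (\<Sum>k\<in>K. (a k - d k)\<^sup>2) + 2 * (\<Sum>k\<in>K. (d k - b k)\<^sup>2)"
proof -
  have "(a k - b k)\<^sup>2 \<le> 2 * (a k - d k)\<^sup>2 + 2 * (d k - b k)\<^sup>2" for k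
    using sum_squares_bound[of "a k - d k" "d k - b k"] by (simp add: power2_eq_square algebra_simps)
  then show ?thesis unfolding sum_distrib_left sum.distrib[symmetric] by (rule sum_mono)
qed

text \<open>The representatives are compared with x / sqrt n and y / sqrt n, whose inner product has
  mean \<rho>. With \<kappa> = sqrt n the two squared distances, of total mean at most 12/n,
  contribute 6 / sqrt n, and the squared norms contribute 1 / sqrt n; hence the 7.\<close>

lemma expectation_discretized_inner_le:
  fixes N :: nat and c :: "nat \<Rightarrow> nat \<Rightarrow> real"
  assumes \<rho>: "-1 \<le> \<rho>" "\<rho> \<le> 1" and n: "n \<ge> 1"
    and X: "X \<in> gauss n \<rightarrow>\<^sub>M count_space {..<N}"
    and c: "\<And>i. (\<Sum>k<n. (c i k)\<^sup>2) = 1"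
    and close: "\<And>x. x \<in> space (gauss n) \<Longrightarrow> (\<Sum>k<n. (c (X x) k - unit_dir n x k)\<^sup>2) \<le> 1 / n"
  shows "(\<integral>p. (\<Sum>k<n. c (X (fst p)) k * c (X (corr_partner n \<rho> (fst p) (snd p))) k) \<partial>(gauss n \<Otimes>\<^sub>M gauss n))
     \<le> \<rho> + 7 / sqrt n"
proof -
  let ?P = "gauss n \<Otimes>\<^sub>M gauss n"
  let ?y = "\<lambda>p. corr_partner n \<rho> (fst p) (snd p)"
  interpret prob_space ?P by (rule prob_space_gauss_pair)
  define S where "S x = (\<Sum>k<n. (x k)\<^sup>2)" for x :: "nat \<Rightarrow> real"
  define Q where "Q x = (S x / n - 1)\<^sup>2" for x
  define T where "T p = (\<Sum>k<n. fst p k * ?y p k)" for p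
  have Q: "integrable (gauss n) Q" "integral\<^sup>L (gauss n) Q = 2 / n"
    unfolding Q_def[abs_def] S_def by (rule integrable_gauss_norm_sq_dev[OF n], rule integral_gauss_norm_sq_dev[OF n])
  have S: "integrable (gauss n) S" "integral\<^sup>L (gauss n) S = n"
    unfolding S_def[abs_def] by (rule integrable_gauss_norm_sq, rule integral_gauss_norm_sq)
  have hb_fst: "has_bochner_integral ?P (\<lambda>p. f (fst p)) (integral\<^sup>L (gauss n) f)" if f: "integrable (gauss n) f" for f :: "_ \<Rightarrow> real"
  proof -
    have "integrable (distr ?P (gauss n) fst) f" using f by (simp only: distr_gauss_pair_fst)
    then have "integrable ?P (\<lambda>p. f (fst p))" by (rule integrable_distr[OF measurable_fst])
    moreover have "(\<integral>p. f (fst p) \<partial>?P) = integral\<^sup>L (gauss n) f"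
      using integral_distr[OF measurable_fst borel_measurable_integrable[OF f], of "gauss n"] by (simp only: distr_gauss_pair_fst)
    ultimately show ?thesis by (simp add: has_bochner_integral_iff)
  qed
  have hb_y: "has_bochner_integral ?P (\<lambda>p. f (?y p)) (integral\<^sup>L (gauss n) f)" if f: "integrable (gauss n) f" for f :: "_ \<Rightarrow> real"
  proof -
    have "integrable (distr ?P (gauss n) ?y) f" using f by (simp only: distr_corr_partner[OF \<rho> n])
    then have "integrable ?P (\<lambda>p. f (?y p))" by (rule integrable_distr[OF measurable_corr_partner[of n \<rho>]])
    moreover have "(\<integral>p. f (?y p) \<partial>?P) = integral\<^sup>L (gauss n) f"
      using integral_distr[OF measurable_corr_partner[of n \<rho>] borel_measurable_integrable[OF f]] by (simp only: distr_corr_partner[OF \<rho> n])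
    ultimately show ?thesis by (simp add: has_bochner_integral_iff)
  qed
  have hbT: "has_bochner_integral ?P T (n * \<rho>)"
    unfolding T_def[abs_def] has_bochner_integral_iff using integrable_corr_inner integral_corr_inner by blast
  have const: "has_bochner_integral ?P (\<lambda>_. r) r" for r :: real
    using prob_space by (simp add: has_bochner_integral_iff)
  \<comment> \<open>A pointwise majorant whose mean is computable exactly. The 4/n collects the cell
    errors of both endpoints, and the \<open>Q\<close> terms the deviations of their norms.\<close>
  define B where "B p = 1 / n * T p + sqrt n / 2 * (4 / n + (2 * Q (fst p) + 2 * Q (?y p))) + 1 / (2 * sqrt n) * (1 + 1 / n * S (fst p))" for p
  have "has_bochner_integral ?P B (1 / n * (n * \<rho>) + sqrt n / 2 * (4 / n + (2 * (2 / n) + 2 * (2 / n))) + 1 / (2 * sqrt n) * (1 + 1 / n * n))"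
    unfolding B_def[abs_def]
    by (intro has_bochner_integral_add has_bochner_integral_mult_right hbT const
        hb_fst[OF Q(1), unfolded Q(2)] hb_y[OF Q(1), unfolded Q(2)] hb_fst[OF S(1), unfolded S(2)])
  also have "1 / n * (n * \<rho>) + sqrt n / 2 * (4 / n + (2 * (2 / n) + 2 * (2 / n))) + 1 / (2 * sqrt n) * (1 + 1 / n * n) = \<rho> + 7 / sqrt n"
  proof -
    have "sqrt n / n = 1 / sqrt n" using n by (simp add: real_div_sqrt divide_simps)
    moreover have "sqrt n / 2 * (4 / n + (2 * (2 / n) + 2 * (2 / n))) = 6 * (sqrt n / n)" by simp
    ultimately have "sqrt n / 2 * (4 / n + (2 * (2 / n) + 2 * (2 / n))) = 6 / sqrt n" by simp
    moreover have "1 / (2 * sqrt n) * (1 + 1 / n * n) = 1 / sqrt n" using n by simp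
    moreover have "1 / n * (n * \<rho>) = \<rho>" using n by simp
    ultimately show ?thesis by (simp add: add_divide_distrib[symmetric])
  qed
  finally have B: "integrable ?P B" "integral\<^sup>L ?P B = \<rho> + 7 / sqrt n" by (auto simp: has_bochner_integral_iff)
  have D: "(\<Sum>k<n. (c (X x) k - x k / sqrt n)\<^sup>2) \<le> 2 / n + 2 * Q x" if "x \<in> space (gauss n)" for x
  proof -
    have "(\<Sum>k<n. (c (X x) k - x k / sqrt n)\<^sup>2) \<le> 2 * (\<Sum>k<n. (c (X x) k - unit_dir n x k)\<^sup>2) + 2 * (\<Sum>k<n. (unit_dir n x k - x k / sqrt n)\<^sup>2)"
      by (rule sum_sq_diff_triangle)
    also have "\<dots> \<le> 2 * (1 / n) + 2 * Q x"
      unfolding Q_def S_def using close[OF that] unit_dir_close[OF n] by (intro add_mono mult_left_mono) auto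
    finally show ?thesis by simp
  qed
  have "(\<integral>p. (\<Sum>k<n. c (X (fst p)) k * c (X (?y p)) k) \<partial>?P) \<le> integral\<^sup>L ?P B"
  proof (rule integral_mono)
    show "integrable ?P (\<lambda>p. \<Sum>k<n. c (X (fst p)) k * c (X (?y p)) k)"
      by (rule integrable_finite_pair[OF measurable_compose[OF measurable_fst X, of "gauss n"]
            measurable_compose[OF measurable_corr_partner[of n \<rho>] X], of "\<lambda>i j. \<Sum>k<n. c i k * c j k"])
    show "integrable ?P B" by (rule B)
    fix p assume p: "p \<in> space ?P"
    have sp: "fst p \<in> space (gauss n)" "?y p \<in> space (gauss n)"
      using p measurable_space[OF measurable_corr_partner p] by (auto simp: space_pair_measure)
    have "(\<Sum>k<n. c (X (fst p)) k * c (X (?y p)) k) \<le> (\<Sum>k<n. (fst p k / sqrt n) * (?y p k / sqrt n))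
      + sqrt n / 2 * ((\<Sum>k<n. (c (X (fst p)) k - fst p k / sqrt n)\<^sup>2) + (\<Sum>k<n. (c (X (?y p)) k - ?y p k / sqrt n)\<^sup>2))
      + 1 / (2 * sqrt n) * ((\<Sum>k<n. (c (X (?y p)) k)\<^sup>2) + (\<Sum>k<n. (fst p k / sqrt n)\<^sup>2))"
      using n by (intro inner_perturb_le) simp
    also have "(\<Sum>k<n. (fst p k / sqrt n) * (?y p k / sqrt n)) = 1 / n * T p"
      by (simp add: T_def sum_divide_distrib)
    also have "(\<Sum>k<n. (fst p k / sqrt n)\<^sup>2) = 1 / n * S (fst p)"
      by (simp add: S_def power_divide sum_divide_distrib)
    also have "(\<Sum>k<n. (c (X (?y p)) k)\<^sup>2) = 1" by (rule c)
    also have "1 / n * T p + sqrt n / 2 * ((\<Sum>k<n. (c (X (fst p)) k - fst p k / sqrt n)\<^sup>2) + (\<Sum>k<n. (c (X (?y p)) k - ?y p k / sqrt n)\<^sup>2))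
       + 1 / (2 * sqrt n) * (1 + 1 / n * S (fst p)) \<le> B p"
    proof -
      have "(\<Sum>k<n. (c (X (fst p)) k - fst p k / sqrt n)\<^sup>2) + (\<Sum>k<n. (c (X (?y p)) k - ?y p k / sqrt n)\<^sup>2)
          \<le> 4 / n + (2 * Q (fst p) + 2 * Q (?y p))"
        using add_mono[OF D[OF sp(1)] D[OF sp(2)]] by simp
      then show ?thesis unfolding B_def by (intro add_right_mono add_left_mono mult_left_mono) simp_all
    qed
    finally show "(\<Sum>k<n. c (X (fst p)) k * c (X (?y p)) k) \<le> B p" .
  qed
  then show ?thesis using B by simp
qed

text \<open>Loops of the Gaussian graph contribute to neither objective, and dividing by the weight of
  the remaining edges does not change the ratio.\<close>
lemma gaussian_graph_ratio:
  fixes n :: nat and \<rho> :: real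
  assumes "H3" and \<rho>: "-1 \<le> \<rho>" "\<rho> \<le> 0" and n: "n \<ge> 3" and pos: "1 - \<rho> - 7 / sqrt n > 0"
  obtains N w where "weighted_graph N w"
    "ProdG N w / SDP_Prod N w \<le> (1 - Fstar 3 \<rho>) / (1 - \<rho> - 7 / sqrt n)"
proof -
  have n1: "n \<ge> 1" and \<rho>1: "\<rho> \<le> 1" using n \<rho> by auto
  obtain N X and c :: "nat \<Rightarrow> nat \<Rightarrow> real" where N: "n \<le> N" and X: "X \<in> gauss n \<rightarrow>\<^sub>M count_space {..<N}"
    and c: "\<And>i. (\<Sum>k<n. (c i k)\<^sup>2) = 1"
    and close: "\<And>x. x \<in> space (gauss n) \<Longrightarrow> (\<Sum>k<n. (c (X x) k - unit_dir n x k)\<^sup>2) \<le> 1 / n"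
    using sphere_discretization[OF n1] by blast
  let ?P = "gauss n \<Otimes>\<^sub>M gauss n"
  let ?y = "\<lambda>p. corr_partner n \<rho> (fst p) (snd p)"
  interpret prob_space ?P by (rule prob_space_gauss_pair)
  note X' = measurable_compose[OF measurable_fst X, of "gauss n"]
  note Y' = measurable_compose[OF measurable_corr_partner[of n \<rho>] X]
  define \<mu> where "\<mu> i j = prob {p \<in> space ?P. X (fst p) = i \<and> X (?y p) = j}" for i j
  \<comment> \<open>An undirected edge collects both orders of its endpoints.\<close>
  define w0 where "w0 i j = \<mu> i j + \<mu> j i" for i j
  have w0: "w0 i j \<ge> 0" for i j by (simp add: w0_def \<mu>_def)
  \<comment> \<open>Symmetry folds the two orders of an edge together, and \<open>ip i i = 1\<close>
    makes the loop terms 1/4 - 1/4 vanish.\<close>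
  have obj: "edge_obj N w0 ip = (1 - expectation (\<lambda>p. ip (X (fst p)) (X (?y p)))) / 4"
    if sym: "\<And>i j. ip i j = ip j i" and diag: "\<And>i. i < N \<Longrightarrow> ip i i = 1" for ip
  proof -
    have "expectation (\<lambda>p. 1/4 - 1/4 * ip (X (fst p)) (X (?y p))) = (\<Sum>i<N. \<Sum>j<N. (1/4 - 1/4 * ip i j) * \<mu> i j)"
      unfolding \<mu>_def by (rule expectation_finite_pair[OF X' Y', of "\<lambda>i j. 1/4 - 1/4 * ip i j"])
    also have "\<dots> = (\<Sum>j<N. (1/4 - 1/4 * ip j j) * \<mu> j j) + (\<Sum>j<N. \<Sum>i<j. (1/4 - 1/4 * ip i j) * \<mu> i j + (1/4 - 1/4 * ip j i) * \<mu> j i)"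
      by (rule sum_square_split)
    also have "(\<Sum>j<N. (1/4 - 1/4 * ip j j) * \<mu> j j) = 0" by (simp add: diag)
    also have "(\<Sum>j<N. \<Sum>i<j. (1/4 - 1/4 * ip i j) * \<mu> i j + (1/4 - 1/4 * ip j i) * \<mu> j i) = edge_obj N w0 ip"
      unfolding edge_obj_def by (intro sum.cong refl) (simp only: sym[of j i for j i] w0_def, simp add: algebra_simps)
    finally have "edge_obj N w0 ip = expectation (\<lambda>p. 1/4 - 1/4 * ip (X (fst p)) (X (?y p)))" by simp
    also have "\<dots> = expectation (\<lambda>p. 1/4) - expectation (\<lambda>p. 1/4 * ip (X (fst p)) (X (?y p)))"
      by (intro Bochner_Integration.integral_diff integrable_const integrable_mult_right integrable_finite_pair[OF X' Y'])
    also have "\<dots> = (1 - expectation (\<lambda>p. ip (X (fst p)) (X (?y p)))) / 4"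
      using prob_space by simp
    finally show ?thesis .
  qed
  define ipc where "ipc i j = (\<Sum>k<n. c i k * c j k)" for i j
  have "edge_obj N w0 ipc = (1 - expectation (\<lambda>p. ipc (X (fst p)) (X (?y p)))) / 4"
    using c by (intro obj) (auto simp: ipc_def mult.commute power2_eq_square)
  moreover have "expectation (\<lambda>p. ipc (X (fst p)) (X (?y p))) \<le> \<rho> + 7 / sqrt n"
    unfolding ipc_def by (rule expectation_discretized_inner_le[OF \<rho>(1) \<rho>1 n1 X c close])
  ultimately have objc: "edge_obj N w0 ipc \<ge> (1 - \<rho> - 7 / sqrt n) / 4" by simp
  \<comment> \<open>The weight off the loops is positive: it is at least twice the objective of
    \<open>ipc\<close>, which \<open>pos\<close> and \<open>objc\<close> keep above 0.\<close>
  define W where "W = (\<Sum>j<N. \<Sum>i<j. w0 i j)"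
  have "edge_obj N w0 ipc \<le> (\<Sum>j<N. \<Sum>i<j. w0 i j * (1/2))"
    unfolding edge_obj_def
  proof (intro sum_mono mult_left_mono w0)
    fix i j
    have "\<bar>ipc i j\<bar> \<le> 1" unfolding ipc_def by (intro abs_sum_mult_le_1) (simp_all add: c)
    then show "1/4 - 1/4 * ipc i j \<le> 1/2" by (simp add: abs_le_iff)
  qed
  also have "\<dots> = W / 2" by (simp add: W_def sum_divide_distrib)
  finally have "edge_obj N w0 ipc \<le> W / 2" .
  moreover have "0 < edge_obj N w0 ipc" using pos by (intro less_le_trans[OF _ objc]) simp
  ultimately have W: "W > 0" by linarith
  define w where "w i j = w0 i j / W" for i j
  have wg: "weighted_graph N w"
    using W w0 by (auto simp: weighted_graph_def w_def sum_divide_distrib[symmetric] W_def[symmetric])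
  have scale: "edge_obj N w ip = edge_obj N w0 ip / W" for ip
    by (simp add: edge_obj_def w_def sum_divide_distrib)
  have prod: "ProdG N w \<le> (1 - Fstar 3 \<rho>) / 4 / W"
    unfolding ProdG_def
  proof (rule cSUP_least)
    have "(\<lambda>_. axis 1 1) \<in> {f :: nat \<Rightarrow> real^3. \<forall>i<N. f i \<in> sphere 0 1}" by (simp add: norm_axis_1)
    then show "{f :: nat \<Rightarrow> real^3. \<forall>i<N. f i \<in> sphere 0 1} \<noteq> {}"
      by (metis empty_iff)
    fix f :: "nat \<Rightarrow> real^3" assume "f \<in> {f. \<forall>i<N. f i \<in> sphere 0 1}"
    then have f: "norm (f i) = 1" if "i < N" for i using that by simp
    \<comment> \<open>A labelling of the vertices is a function on n-dimensional space that is
      constant on cells and has unit values, so the hypothesis bounds its stability from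
      below.\<close>
    have "(\<lambda>x. f (X x)) \<in> borel_measurable (gauss n)"
      by (rule measurable_compose[OF X]) simp
    moreover have "norm (f (X x)) \<le> 1" if "x \<in> space (gauss n)" for x
      using measurable_space[OF X that] f[of "X x"] by simp
    ultimately have "Stab n \<rho> f_opt3 \<le> Stab n \<rho> (\<lambda>x. f (X x))"
      using \<open>H3\<close> n \<rho> unfolding H3_def by (metis atLeastAtMost_iff)
    then have "Fstar 3 \<rho> \<le> expectation (\<lambda>p. inner (f (X (fst p))) (f (X (?y p))))"
      unfolding Stab_f_opt3[OF \<rho>(1) \<rho>1 n] by (simp only: Stab_def)
    moreover have "edge_obj N w0 (\<lambda>i j. inner (f i) (f j)) = (1 - expectation (\<lambda>p. inner (f (X (fst p))) (f (X (?y p))))) / 4"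
      using f by (intro obj) (auto simp: inner_commute norm_eq_1)
    ultimately show "edge_obj N w (\<lambda>i j. inner (f i) (f j)) \<le> (1 - Fstar 3 \<rho>) / 4 / W"
      unfolding scale using W by (intro divide_right_mono) auto
  qed
  \<comment> \<open>Zero padding from n to N coordinates leaves the inner products
    unchanged.\<close>
  define c' where "c' i k = (if k < n then c i k else 0)" for i k
  have c': "(\<Sum>k<N. c' i k * c' j k) = ipc i j" for i j
    unfolding ipc_def using N by (intro sum.mono_neutral_cong_right) (auto simp: c'_def)
  have sdp: "SDP_Prod N w \<ge> (1 - \<rho> - 7 / sqrt n) / 4 / W"
  proof -
    have "(1 - \<rho> - 7 / sqrt n) / 4 / W \<le> edge_obj N w ipc"
      unfolding scale using W objc by (intro divide_right_mono) auto
    also have "\<dots> = edge_obj N w (\<lambda>i j. \<Sum>k<N. c' i k * c' j k)" by (simp only: c')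
    also have "\<dots> \<le> SDP_Prod N w"
    proof (rule SDP_Prod_upper[OF wg])
      show "(\<Sum>k<N. (c' i k)\<^sup>2) = 1" for i
        using c'[of i i] c[of i] by (simp add: ipc_def power2_eq_square)
    qed
    finally show ?thesis .
  qed
  have "ProdG N w / SDP_Prod N w \<le> ((1 - Fstar 3 \<rho>) / 4 / W) / ((1 - \<rho> - 7 / sqrt n) / 4 / W)"
    using prod sdp pos W Fstar3_le_1[OF \<rho>(1) \<rho>1] by (intro frac_le) auto
  also have "\<dots> = (1 - Fstar 3 \<rho>) / (1 - \<rho> - 7 / sqrt n)" using W by simp
  finally show thesis using that wg by blast
qed

section \<open>The infimum over all graphs\<close>

theorem theorem2p8:
  assumes "H3"
  shows "(INF G \<in> {(N, w). weighted_graph N w}. ProdG (fst G) (snd G) / SDP_Prod (fst G) (snd G)) = alpha_BOV"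
proof (rule antisym)
  let ?r = "\<lambda>G. ProdG (fst G) (snd G) / SDP_Prod (fst G) (snd G)"
  let ?A = "{(N, w). weighted_graph N w}"
  let ?I = "INF G \<in> ?A. ?r G"
  \<comment> \<open>A real \<open>INF\<close> lies below its members only over a set bounded
    below.\<close>
  have bdd: "bdd_below (?r ` ?A)"
    by (rule bdd_belowI2[of _ alpha_BOV]) (auto intro: alpha_BOV_le_ratio)
  \<comment> \<open>A single edge of weight 1: the greatest-lower-bound property of
    \<open>INF\<close> asks for a nonempty set.\<close>
  have "(2, \<lambda>_ _. 1) \<in> ?A" by (simp add: weighted_graph_def numeral_2_eq_2)
  then show "alpha_BOV \<le> ?I"
    by (intro cINF_greatest) (auto intro: alpha_BOV_le_ratio)
  \<comment> \<open>The graph changes with n but the infimum does not, so the bound passes to the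
    limit.\<close>
  have neg: "?I \<le> (1 - Fstar 3 \<rho>) / (1 - \<rho>)" if \<rho>: "-1 \<le> \<rho>" "\<rho> \<le> 0" for \<rho>
  proof (rule LIMSEQ_le_const)
    show "(\<lambda>n. (1 - Fstar 3 \<rho>) / (1 - \<rho> - 7 / sqrt (real n))) \<longlonglongrightarrow> (1 - Fstar 3 \<rho>) / (1 - \<rho>)"
    proof -
      have "(\<lambda>n. 7 / sqrt (real n)) \<longlonglongrightarrow> 0" by real_asymp
      then have "(\<lambda>n. (1 - Fstar 3 \<rho>) / (1 - \<rho> - 7 / sqrt (real n))) \<longlonglongrightarrow> (1 - Fstar 3 \<rho>) / (1 - \<rho> - 0)"
        using \<rho> by (intro tendsto_intros) auto
      then show ?thesis by simp
    qed
    show "\<exists>n0. \<forall>n\<ge>n0. ?I \<le> (1 - Fstar 3 \<rho>) / (1 - \<rho> - 7 / sqrt (real n))"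
    proof (intro exI[of _ 50] allI impI)
      \<comment> \<open>Any n > 49 gives 7 / sqrt n < 1 \<le> 1 - \<rho>, so the denominator is
        positive.\<close>
      fix n :: nat assume "n \<ge> 50"
      then have "sqrt 49 < sqrt (real n)" by (intro real_sqrt_less_mono) simp
      then have "7 / sqrt (real n) < 1" using real_sqrt_abs[of "7::real"] by (simp add: divide_less_eq)
      then have "1 - \<rho> - 7 / sqrt (real n) > 0" using \<rho> by linarith
      then obtain N w where "weighted_graph N w" "ProdG N w / SDP_Prod N w \<le> (1 - Fstar 3 \<rho>) / (1 - \<rho> - 7 / sqrt (real n))"
        using gaussian_graph_ratio[OF assms \<rho>, of n] \<open>n \<ge> 50\<close> by auto
      then show "?I \<le> (1 - Fstar 3 \<rho>) / (1 - \<rho> - 7 / sqrt (real n))"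
        by (intro cINF_lower2[OF bdd, of "(N, w)"]) auto
    qed
  qed
  show "?I \<le> alpha_BOV"
    unfolding alpha_BOV_def
  proof (rule cINF_greatest)
    fix \<rho> :: real assume \<rho>: "\<rho> \<in> {-1..<1}"
    show "?I \<le> (1 - Fstar 3 \<rho>) / (1 - \<rho>)"
    proof (cases "\<rho> \<le> 0")
      case False
      \<comment> \<open>The hypothesis says nothing about positive \<rho>; the graphs built for
        \<rho> = 0 already bring the infimum down to 1.\<close>
      have "?I \<le> 1" using neg[of 0] by (simp add: Fstar3_0)
      also have "1 \<le> (1 - Fstar 3 \<rho>) / (1 - \<rho>)"
        using False \<rho> Fstar3_le_self[of \<rho>] by simp
      finally show ?thesis .
    qed (use neg \<rho> in auto)
  qed simp
qed

end
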